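(* Let $A=\mathbb{C}[\partial]V$ be an associative conformal algebra which is free as a $\mathbb{C}[\partial]$-module (with $A\cong\mathbb{C}[\partial]\otimes V$ for a vector space $V$), and let $Q=\mathbb{C}[\partial]x$ be a free $\mathbb{C}[\partial]$-module of rank 1. Set $E=A\oplus Q$ as a $\mathbb{C}[\partial]$-module. Let $\mathcal{FAC}(A)$ be the set of flag datums of $A$. Then: (1) $\mathrm{CExtd}(E,A)\cong\mathcal{AH}_A^2(Q,A)\cong\mathcal{FAC}(A)/\equiv$, where $\equiv$ is the equivalence relation on $\mathcal{FAC}(A)$ given by: $(h_\lambda(\cdot,\partial),D_\lambda,g_\lambda(\cdot,\partial),T_\lambda,Q_0(\lambda,\partial),P(\lambda,\partial))\equiv(h'_\lambda(\cdot,\partial),D'_\lambda,g'_\lambda(\cdot,\partial),T'_\lambda,Q'_0(\lambda,\partial),P'(\lambda,\partial))$ if and only if $h_\lambda(\cdot,\partial)=h'_\lambda(\cdot,\partial)$, $g_\lambda(\cdot,\partial)=g'_\lambda(\cdot,\partial)$ and there exist $T_0\in A$ and $\beta\in\mathbb{C}\setminus\{0\}$ such that for all $a\in A$: $$D_\lambda(a)=a_\lambda T_0+\beta D'_\lambda(a)-h_\lambda(a,\partial)T_0,$$ $$T_\lambda(a)={T_0}_\lambda a+\beta T'_\lambda(a)-g_\lambda(a,\partial)T_0,$$ $$P(\lambda,\partial)=h'_\lambda(T_0,\partial)+g'_\lambda(T_0,\partial)+\beta P'(\lambda,\partial),$$ $$Q_0(\lambda,\partial)={T_0}_\lambda T_0+\beta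 D'_\lambda(T_0)+\beta T'_\lambda(T_0)+\beta^2Q'_0(\lambda,\partial)-P(\lambda,\partial)T_0.$$ The bijection $\mathcal{FAC}(A)/\equiv\ \to\mathrm{CExtd}(E,A)$ sends the class of $(h_\lambda(\cdot,\partial),D_\lambda,g_\lambda(\cdot,\partial),T_\lambda,Q_0(\lambda,\partial),P(\lambda,\partial))$ to the class of $AC(A,\mathbb{C}[\partial]x\,|\,h_\lambda(\cdot,\partial),D_\lambda,g_\lambda(\cdot,\partial),T_\lambda,Q_0(\lambda,\partial),P(\lambda,\partial))$. (2) $\mathrm{CExtd}'(E,A)\cong\mathcal{AH}^2(Q,A)\cong\mathcal{FAC}(A)/\approx$, where $\approx$ is the equivalence relation on $\mathcal{FAC}(A)$ for which two flag datums (unprimed and primed as in (1)) are related if and only if $h_\lambda(\cdot,\partial)=h'_\lambda(\cdot,\partial)$, $g_\lambda(\cdot,\partial)=g'_\lambda(\cdot,\partial)$ and there exists $T_0\in A$ such that the four displayed equations of (1) hold with $\beta=1$ for all $a\in A$. The bijection $\mathcal{FAC}(A)/\approx\ \to\mathrm{CExtd}'(E,A)$ sends the class of a flag datum to the class of the corresponding algebra $AC(A,\mathbb{C}[\partial]x\,|\,h_\lambda(\cdot,\partial),D_\lambda,g_\lambda(\cdot,\partial),T_\lambda,Q_0(\lambda,\partial),P(\lambda,\partial))$.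
   Context: An associative conformal algebra is a $\mathbb{C}[\partial]$-module $A$ with a $\mathbb{C}$-bilinear $\lambda$-product $A\times A\to A[\lambda]$, $(a,b)\mapsto a_\lambda b$, such that $(\partial a)_\lambda b=-\lambda a_\lambda b$, $a_\lambda\partial b=(\lambda+\partial)a_\lambda b$ and $a_\lambda(b_\mu c)=(a_\lambda b)_{\lambda+\mu}c$. All maps are extended coefficientwise to polynomials in $\lambda,\mu$. For $\mathbb{C}[\partial]$-modules $U,V$, a left conformal linear map is a $\mathbb{C}$-linear map $a_\lambda:U\to V[\lambda]$ with $a_\lambda(\partial u)=-\lambda a_\lambda u$; a (right) conformal linear map is one with $a_\lambda(\partial u)=(\partial+\lambda)a_\lambda u$. (Here $\mathbb{C}[\lambda,\partial]=(\mathbb{C}[\partial])[\lambda]$.) A conformal bilinear map $f_\lambda:U\times V\to W[\lambda]$ satisfies $f_\lambda(\partial u,v)=-\lambda f_\lambda(u,v)$, $f_\lambda(u,\partial v)=(\partial+\lambda)f_\lambda(u,v)$. **Flag datums.** A flag datum of $A=\mathbb{C}[\partial]V$ (free) is a 6-tuple $(h_\lambda(\cdot,\partial),D_\lambda,g_\lambda(\cdot,\partial),T_\lambda,Q_0(\lambda,\partial),P(\lambda,\partial))$ where $P(\lambda,\partial)\in\mathbb{C}[\lambda,\partial]$, $Q_0(\lambda,\partial)\in A[\lambda]$, $h_\lambda(\cdot,\partial):A\to\mathbb{C}[\lambda,\partial]$ and $D_\lambda:A\to A[\lambda]$ are left conformal linear maps, $g_\lambda(\cdot,\partial):A\to\mathbb{C}[\lambda,\partial]$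 and $T_\lambda:A\to A[\lambda]$ are conformal linear maps, such that for all $a,b\in V$: 1. $D_{\lambda+\mu}(a_\lambda b)=a_\lambda(D_\mu(b))+h_\mu(b,\lambda+\partial)D_\lambda(a)$ 2. $h_\mu(b,\lambda+\partial)h_\lambda(a,\partial)=h_{\lambda+\mu}(a_\lambda b,\partial)$ 3. $a_\lambda(T_\mu(b))+g_\mu(b,\lambda+\partial)D_\lambda(a)=(D_\lambda(a))_{\lambda+\mu}b+h_\lambda(a,-\lambda-\mu)T_{\lambda+\mu}(b)$ 4. $g_\mu(b,\lambda+\partial)h_\lambda(a,\partial)=h_\lambda(a,-\lambda-\mu)g_{\lambda+\mu}(b,\partial)$ 5. $T_\lambda(a_\mu b)=(T_\lambda(a))_{\lambda+\mu}b+g_\lambda(a,-\lambda-\mu)T_{\lambda+\mu}(b)$ 6. $g_\lambda(a_\mu b,\partial)=g_\lambda(a,-\lambda-\mu)g_{\lambda+\mu}(b,\partial)$ 7. $P(\mu,\lambda+\partial)D_\lambda(a)=D_{\lambda+\mu}(D_\lambda(a))+h_\lambda(a,-\lambda-\mu)Q_0(\lambda+\mu,\partial)-a_\lambda(Q_0(\mu,\partial))$ 8. $P(\mu,\lambda+\partial)h_\lambda(a,\partial)=h_\lambda(a,-\lambda-\mu)P(\lambda+\mu,\partial)+h_{\lambda+\mu}(D_\lambda(a),\partial)$ 9. $T_\lambda(D_\mu(a))+h_\mu(a,\lambda+\partial)Q_0(\lambda,\partial)=D_{\lambda+\mu}(T_\lambda(a))+g_\lambda(a,-\lambda-\mu)Q_0(\lambda+\mu,\partial)$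 10. $g_\lambda(D_\mu(a),\partial)+h_\mu(a,\lambda+\partial)P(\lambda,\partial)=h_{\lambda+\mu}(T_\lambda(a),\partial)+g_\lambda(a,-\lambda-\mu)P(\lambda+\mu,\partial)$ 11. $T_\lambda(T_\mu(a))+g_\mu(a,\lambda+\partial)Q_0(\lambda,\partial)=Q_0(\lambda,\partial)_{\lambda+\mu}a+P(\lambda,-\lambda-\mu)T_{\lambda+\mu}(a)$ 12. $g_\lambda(T_\mu(a),\partial)+g_\mu(a,\lambda+\partial)P(\lambda,\partial)=P(\lambda,-\lambda-\mu)g_{\lambda+\mu}(a,\partial)$ 13. $T_\lambda(Q_0(\mu,\partial))+P(\mu,\lambda+\partial)Q_0(\lambda,\partial)=D_{\lambda+\mu}(Q_0(\lambda,\partial))+P(\lambda,-\lambda-\mu)Q_0(\lambda+\mu,\partial)$ 14. $g_\lambda(Q_0(\mu,\partial),\partial)+P(\mu,\lambda+\partial)P(\lambda,\partial)=h_{\lambda+\mu}(Q_0(\lambda,\partial),\partial)+P(\lambda,-\lambda-\mu)P(\lambda+\mu,\partial)$ $AC(A,\mathbb{C}[\partial]x\,|\,h_\lambda(\cdot,\partial),D_\lambda,g_\lambda(\cdot,\partial),T_\lambda,Q_0(\lambda,\partial),P(\lambda,\partial))$ denotes the $\mathbb{C}[\partial]$-module $A\oplus\mathbb{C}[\partial]x$ with the $\lambda$-product determined by conformal sesquilinearity and, for $a,b\in V$, $(a,0)_\lambda(b,0)=(a_\lambda b,0)$, $(0,x)_\lambda(0,x)=(Q_0(\lambda,\partial),P(\lambda,\partial)x)$,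 $(a,0)_\lambda(0,x)=(D_\lambda(a),h_\lambda(a,\partial)x)$, $(0,x)_\lambda(a,0)=(T_\lambda(a),g_\lambda(a,\partial)x)$. **Extending structures.** An extending datum of $A$ by $Q$ is a system $\Omega(A,Q)=(\leftharpoonup_\lambda,\rightharpoonup_\lambda,\lhd_\lambda,\rhd_\lambda,f_\lambda,\circ_\lambda)$ of conformal bilinear maps $\leftharpoonup_\lambda:A\times Q\to A[\lambda]$, $\rightharpoonup_\lambda:A\times Q\to Q[\lambda]$, $\lhd_\lambda:Q\times A\to Q[\lambda]$, $\rhd_\lambda:Q\times A\to A[\lambda]$, $f_\lambda:Q\times Q\to A[\lambda]$, $\circ_\lambda:Q\times Q\to Q[\lambda]$. It is an associative conformal extending structure if the $\lambda$-product $(a,y)_\lambda(b,z)=(a_\lambda b+a\leftharpoonup_\lambda z+y\rhd_\lambda b+f_\lambda(y,z),\ a\rightharpoonup_\lambda z+y\lhd_\lambda b+y\circ_\lambda z)$ makes $A\times Q$ an associative conformal algebra. $\mathcal{TC}(A,Q)$ is the set of these. $\Omega(A,Q)\equiv\Omega'(A,Q)$ (primed maps for $\Omega'$) means there are a $\mathbb{C}[\partial]$-module homomorphism $u:Q\to A$ and $v\in\mathrm{Aut}_{\mathbb{C}[\partial]}(Q)$ with, for all $a\in A$, $y,z\in Q$: $a\rightharpoonup_\lambda y=v^{-1}(a\rightharpoonup'_\lambda v(y))$; $a\leftharpoonup_\lambda y=a_\lambda u(y)+a\leftharpoonup'_\lambda v(y)-u(a\rightharpoonup_\lambda y)$; $y\lhd_\lambda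 a=v^{-1}(v(y)\lhd'_\lambda a)$; $y\rhd_\lambda a=u(y)_\lambda a+v(y)\rhd'_\lambda a-u(y\lhd_\lambda a)$; $y\circ_\lambda z=v^{-1}(u(y)\rightharpoonup'_\lambda v(z)+v(y)\lhd'_\lambda u(z)+v(y)\circ'_\lambda v(z))$; $f_\lambda(y,z)=u(y)_\lambda u(z)+u(y)\leftharpoonup'_\lambda v(z)+v(y)\rhd'_\lambda u(z)+f'_\lambda(v(y),v(z))-u(y\circ_\lambda z)$. $\Omega\approx\Omega'$ means the same with $v=\mathrm{Id}$. $\mathcal{AH}_A^2(Q,A)=\mathcal{TC}(A,Q)/\equiv$ and $\mathcal{AH}^2(Q,A)=\mathcal{TC}(A,Q)/\approx$. **Classifying sets.** $\varphi:E\to E$ stabilizes $A$ if $\varphi|_A=\mathrm{id}_A$, and co-stabilizes $Q$ if $\pi\varphi=\pi$ for the projection $\pi:E\to Q$. On the set of associative conformal algebra structures on $E$ containing $A$ as a subalgebra, two structures are equivalent if there is an algebra isomorphism between them stabilizing $A$, and cohomologous if there is one stabilizing $A$ and co-stabilizing $Q$. The respective sets of classes are $\mathrm{CExtd}(E,A)$ and $\mathrm{CExtd}'(E,A)$. The symbol $\cong$ between these sets denotes bijection. *)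

theory Defs
  imports "HOL-Analysis.Product_Vector" "HOL-Computational_Algebra.Polynomial"
begin

section \<open>Polynomials over modules\<close>

text \<open>
  The ring of polynomials in the derivation is \<open>complex poly\<close>; a module over it is given by a
  scalar multiplication \<open>s\<close> on a type, as in the locale \<^locale>\<open>module\<close>. For such a module \<open>A\<close> on
  the type \<open>'a\<close>, the type \<open>'a poly\<close> is \<open>A[\<lambda>]\<close>, and \<open>'a poly poly\<close> is \<open>A[\<lambda>][\<mu>]\<close> (the outer
  variable is \<open>\<mu>\<close>). They are modules over \<open>complex poly poly\<close> = \<open>C[\<partial>][\<lambda>]\<close> and
  \<open>complex poly poly poly\<close> = \<open>C[\<partial>][\<lambda>][\<mu>]\<close>, respectively. The ring \<open>C[\<partial>]\<close> is regarded as a module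
  over itself via \<open>(*)\<close>.
\<close>

definition poly_scale :: "('r::zero \<Rightarrow> 'a::ab_group_add \<Rightarrow> 'a) \<Rightarrow> 'r poly \<Rightarrow> 'a poly \<Rightarrow> 'a poly" where
  "poly_scale s p w = (\<Sum>i\<le>degree p. \<Sum>j\<le>degree w. monom (s (coeff p i) (coeff w j)) (i + j))"

abbreviation poly_scale2 :: "('r::zero \<Rightarrow> 'a::ab_group_add \<Rightarrow> 'a) \<Rightarrow>
    'r poly poly \<Rightarrow> 'a poly poly \<Rightarrow> 'a poly poly" where
  "poly_scale2 s \<equiv> poly_scale (poly_scale s)"

definition complex_scale :: "(complex poly \<Rightarrow> 'a \<Rightarrow> 'a) \<Rightarrow> complex \<Rightarrow> 'a \<Rightarrow> 'a" where
  "complex_scale s c = s [:c:]"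

definition complex_poly_scale ::
    "(complex poly \<Rightarrow> 'a::ab_group_add \<Rightarrow> 'a) \<Rightarrow> complex \<Rightarrow> 'a poly \<Rightarrow> 'a poly" where
  "complex_poly_scale s c = poly_scale s [:[:c:]:]"

definition pd :: "complex poly" where "pd = [:0, 1:]"

definition lam1 :: "complex poly poly" where "lam1 = [:0, 1:]"
definition pd1 :: "complex poly poly" where "pd1 = [:pd:]"

definition lam :: "complex poly poly poly" where "lam = [:lam1:]"
definition mu :: "complex poly poly poly" where "mu = [:0, 1:]"
definition pd2 :: "complex poly poly poly" where "pd2 = [:pd1:]"

text \<open>
  Substitutions into \<open>C[\<partial>,\<lambda>,\<mu>]\<close> and \<open>A[\<lambda>,\<mu>]\<close>. For \<open>h = h\<^sub>\<lambda>(\<partial>)\<close> in \<open>C[\<partial>][\<lambda>]\<close>, \<open>coef_at h X Y\<close> is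
  \<open>h\<^sub>X(Y)\<close>. For \<open>w\<close> in \<open>A[\<lambda>]\<close>, \<open>subst_at s w X\<close> is the result of substituting \<open>X\<close> for \<open>\<lambda>\<close>.
  For \<open>F\<^sub>\<lambda> : U \<rightarrow> A[\<lambda>]\<close> and \<open>u\<close> in \<open>U[\<lambda>,\<mu>]\<close>, \<open>app_at s F X u\<close> is \<open>F\<^sub>X(u)\<close>, with \<open>F\<^sub>X\<close>
  extended coefficientwise to polynomials in \<open>\<lambda>\<close> and \<open>\<mu>\<close>.
\<close>

definition coef_at :: "complex poly poly \<Rightarrow> complex poly poly poly \<Rightarrow> complex poly poly poly \<Rightarrow>
    complex poly poly poly" where
  "coef_at h X Y = poly (map_poly (\<lambda>p. poly (map_poly (\<lambda>c. [:[:[:c:]:]:]) p) Y) h) X"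

definition subst_at :: "(complex poly \<Rightarrow> 'a::ab_group_add \<Rightarrow> 'a) \<Rightarrow>
    'a poly \<Rightarrow> complex poly poly poly \<Rightarrow> 'a poly poly" where
  "subst_at s w X = (\<Sum>n\<le>degree w. poly_scale2 s (X ^ n) [:[:coeff w n:]:])"

definition app_at :: "(complex poly \<Rightarrow> 'a::ab_group_add \<Rightarrow> 'a) \<Rightarrow> ('u::zero \<Rightarrow> 'a poly) \<Rightarrow>
    complex poly poly poly \<Rightarrow> 'u poly poly \<Rightarrow> 'a poly poly" where
  "app_at s F X u = (\<Sum>i\<le>degree u. \<Sum>j\<le>degree (coeff u i).
     poly_scale2 s (mu ^ i * lam ^ j) (subst_at s (F (coeff (coeff u i) j)) X))"


section \<open>Conformal maps and associative conformal algebras\<close>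

definition left_conformal_linear :: "(complex poly \<Rightarrow> 'u::ab_group_add \<Rightarrow> 'u) \<Rightarrow>
    (complex poly \<Rightarrow> 'v::ab_group_add \<Rightarrow> 'v) \<Rightarrow> ('u \<Rightarrow> 'v poly) \<Rightarrow> bool" where
  "left_conformal_linear sU sV F \<longleftrightarrow>
     Vector_Spaces.linear (complex_scale sU) (complex_poly_scale sV) F \<and>
     (\<forall>u. F (sU pd u) = poly_scale sV (- lam1) (F u))"

definition conformal_linear :: "(complex poly \<Rightarrow> 'u::ab_group_add \<Rightarrow> 'u) \<Rightarrow>
    (complex poly \<Rightarrow> 'v::ab_group_add \<Rightarrow> 'v) \<Rightarrow> ('u \<Rightarrow> 'v poly) \<Rightarrow> bool" where
  "conformal_linear sU sV F \<longleftrightarrow>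
     Vector_Spaces.linear (complex_scale sU) (complex_poly_scale sV) F \<and>
     (\<forall>u. F (sU pd u) = poly_scale sV (pd1 + lam1) (F u))"

definition conformal_bilinear :: "(complex poly \<Rightarrow> 'u::ab_group_add \<Rightarrow> 'u) \<Rightarrow>
    (complex poly \<Rightarrow> 'v::ab_group_add \<Rightarrow> 'v) \<Rightarrow> (complex poly \<Rightarrow> 'w::ab_group_add \<Rightarrow> 'w) \<Rightarrow>
    ('u \<Rightarrow> 'v \<Rightarrow> 'w poly) \<Rightarrow> bool" where
  "conformal_bilinear sU sV sW f \<longleftrightarrow>
     (\<forall>v. left_conformal_linear sU sW (\<lambda>u. f u v)) \<and> (\<forall>u. conformal_linear sV sW (f u))"

definition assoc_conformal_algebra ::
    "(complex poly \<Rightarrow> 'a::ab_group_add \<Rightarrow> 'a) \<Rightarrow> ('a \<Rightarrow> 'a \<Rightarrow> 'a poly) \<Rightarrow> bool" where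
  "assoc_conformal_algebra s m \<longleftrightarrow>
     module s \<and> conformal_bilinear s s s m \<and>
     (\<forall>a b c. app_at s (m a) lam (subst_at s (m b c) mu) =
              app_at s (\<lambda>d. m d c) (lam + mu) (subst_at s (m a b) lam))"

text \<open>
  \<open>A\<close> is the free module generated by the complex vector space \<open>V\<close>: a basis of \<open>V\<close> over the
  complex numbers is a basis of \<open>A\<close> over \<open>C[\<partial>]\<close>.
\<close>

definition free_over :: "(complex poly \<Rightarrow> 'a::ab_group_add \<Rightarrow> 'a) \<Rightarrow> 'a set \<Rightarrow> bool" where
  "free_over s V \<longleftrightarrow>
     module s \<and> (\<exists>B. V = module.span (complex_scale s) B \<and>
                     module.independent s B \<and> module.span s B = UNIV)"


section \<open>Structures on the direct sum\<close>

abbreviation sum_scale :: "(complex poly \<Rightarrow> 'a::ab_group_add \<Rightarrow> 'a) \<Rightarrow>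
    (complex poly \<Rightarrow> 'q::ab_group_add \<Rightarrow> 'q) \<Rightarrow> complex poly \<Rightarrow> 'a \<times> 'q \<Rightarrow> 'a \<times> 'q" where
  "sum_scale sA sQ \<equiv> module_prod.scale sA sQ"

definition pair_poly :: "'a::ab_group_add poly \<Rightarrow> 'q::ab_group_add poly \<Rightarrow> ('a \<times> 'q) poly" where
  "pair_poly u w = map_poly (\<lambda>c. (c, 0)) u + map_poly (\<lambda>c. (0, c)) w"

text \<open>The associative conformal algebra structures on \<open>A \<oplus> Q\<close> containing \<open>A\<close> as a subalgebra.\<close>

definition sum_structures :: "(complex poly \<Rightarrow> 'a::ab_group_add \<Rightarrow> 'a) \<Rightarrow> ('a \<Rightarrow> 'a \<Rightarrow> 'a poly) \<Rightarrow>
    (complex poly \<Rightarrow> 'q::ab_group_add \<Rightarrow> 'q) \<Rightarrow> ('a \<times> 'q \<Rightarrow> 'a \<times> 'q \<Rightarrow> ('a \<times> 'q) poly) set" where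
  "sum_structures sA m sQ =
     {M. assoc_conformal_algebra (sum_scale sA sQ) M \<and>
         (\<forall>a b. M (a, 0) (b, 0) = pair_poly (m a b) 0)}"

definition conformal_iso :: "(complex poly \<Rightarrow> 'e::ab_group_add \<Rightarrow> 'e) \<Rightarrow> ('e \<Rightarrow> 'e \<Rightarrow> 'e poly) \<Rightarrow>
    ('e \<Rightarrow> 'e \<Rightarrow> 'e poly) \<Rightarrow> ('e \<Rightarrow> 'e) \<Rightarrow> bool" where
  "conformal_iso s M M' \<phi> \<longleftrightarrow>
     module_hom s s \<phi> \<and> bij \<phi> \<and> (\<forall>e e'. map_poly \<phi> (M e e') = M' (\<phi> e) (\<phi> e'))"

definition stabilizes :: "('a \<times> 'q::zero \<Rightarrow> 'a \<times> 'q) \<Rightarrow> bool" where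
  "stabilizes \<phi> \<longleftrightarrow> (\<forall>a. \<phi> (a, 0) = (a, 0))"

definition costabilizes :: "('a \<times> 'q \<Rightarrow> 'a \<times> 'q) \<Rightarrow> bool" where
  "costabilizes \<phi> \<longleftrightarrow> snd \<circ> \<phi> = snd"

definition structure_equiv :: "(complex poly \<Rightarrow> 'a::ab_group_add \<Rightarrow> 'a) \<Rightarrow> ('a \<Rightarrow> 'a \<Rightarrow> 'a poly) \<Rightarrow>
    (complex poly \<Rightarrow> 'q::ab_group_add \<Rightarrow> 'q) \<Rightarrow> ('a \<times> 'q \<Rightarrow> 'a \<times> 'q \<Rightarrow> ('a \<times> 'q) poly) rel" where
  "structure_equiv sA m sQ =
     {(M, M'). M \<in> sum_structures sA m sQ \<and> M' \<in> sum_structures sA m sQ \<and>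
        (\<exists>\<phi>. conformal_iso (sum_scale sA sQ) M M' \<phi> \<and> stabilizes \<phi>)}"

definition structure_cohom :: "(complex poly \<Rightarrow> 'a::ab_group_add \<Rightarrow> 'a) \<Rightarrow> ('a \<Rightarrow> 'a \<Rightarrow> 'a poly) \<Rightarrow>
    (complex poly \<Rightarrow> 'q::ab_group_add \<Rightarrow> 'q) \<Rightarrow> ('a \<times> 'q \<Rightarrow> 'a \<times> 'q \<Rightarrow> ('a \<times> 'q) poly) rel" where
  "structure_cohom sA m sQ =
     {(M, M'). M \<in> sum_structures sA m sQ \<and> M' \<in> sum_structures sA m sQ \<and>
        (\<exists>\<phi>. conformal_iso (sum_scale sA sQ) M M' \<phi> \<and> stabilizes \<phi> \<and> costabilizes \<phi>)}"

definition CExtd where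
  "CExtd sA m sQ = sum_structures sA m sQ // structure_equiv sA m sQ"

definition CExtd' where
  "CExtd' sA m sQ = sum_structures sA m sQ // structure_cohom sA m sQ"


section \<open>Extending structures\<close>

text \<open>
  An extending datum is a tuple \<open>(lh, rh, lt, rt, f, c)\<close>: \<open>lh\<close> and \<open>rh\<close> are the left and right
  harpoons, \<open>lt\<close> and \<open>rt\<close> the left and right triangles, and \<open>c\<close> is the operation on \<open>Q\<close>.
\<close>

type_synonym ('a, 'q) ext_datum =
  "('a \<Rightarrow> 'q \<Rightarrow> 'a poly) \<times> ('a \<Rightarrow> 'q \<Rightarrow> 'q poly) \<times> ('q \<Rightarrow> 'a \<Rightarrow> 'q poly) \<times>
   ('q \<Rightarrow> 'a \<Rightarrow> 'a poly) \<times> ('q \<Rightarrow> 'q \<Rightarrow> 'a poly) \<times> ('q \<Rightarrow> 'q \<Rightarrow> 'q poly)"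

definition ext_product :: "('a::ab_group_add \<Rightarrow> 'a \<Rightarrow> 'a poly) \<Rightarrow> ('a, 'q::ab_group_add) ext_datum \<Rightarrow>
    'a \<times> 'q \<Rightarrow> 'a \<times> 'q \<Rightarrow> ('a \<times> 'q) poly" where
  "ext_product m = (\<lambda>(lh, rh, lt, rt, f, c) (a, y) (b, z).
     pair_poly (m a b + lh a z + rt y b + f y z) (rh a z + lt y b + c y z))"

definition TC :: "(complex poly \<Rightarrow> 'a::ab_group_add \<Rightarrow> 'a) \<Rightarrow> ('a \<Rightarrow> 'a \<Rightarrow> 'a poly) \<Rightarrow>
    (complex poly \<Rightarrow> 'q::ab_group_add \<Rightarrow> 'q) \<Rightarrow> ('a, 'q) ext_datum set" where
  "TC sA m sQ = {(lh, rh, lt, rt, f, c).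
     conformal_bilinear sA sQ sA lh \<and> conformal_bilinear sA sQ sQ rh \<and>
     conformal_bilinear sQ sA sQ lt \<and> conformal_bilinear sQ sA sA rt \<and>
     conformal_bilinear sQ sQ sA f \<and> conformal_bilinear sQ sQ sQ c \<and>
     assoc_conformal_algebra (sum_scale sA sQ) (ext_product m (lh, rh, lt, rt, f, c))}"

definition ext_related :: "('a::ab_group_add \<Rightarrow> 'a \<Rightarrow> 'a poly) \<Rightarrow> ('q::ab_group_add \<Rightarrow> 'a) \<Rightarrow>
    ('q \<Rightarrow> 'q) \<Rightarrow> ('a, 'q) ext_datum \<Rightarrow> ('a, 'q) ext_datum \<Rightarrow> bool" where
  "ext_related m u v = (\<lambda>(lh, rh, lt, rt, f, c) (lh', rh', lt', rt', f', c').
     \<forall>a y z.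
       rh a y = map_poly (inv v) (rh' a (v y)) \<and>
       lh a y = m a (u y) + lh' a (v y) - map_poly u (rh a y) \<and>
       lt y a = map_poly (inv v) (lt' (v y) a) \<and>
       rt y a = m (u y) a + rt' (v y) a - map_poly u (lt y a) \<and>
       c y z = map_poly (inv v) (rh' (u y) (v z) + lt' (v y) (u z) + c' (v y) (v z)) \<and>
       f y z = m (u y) (u z) + lh' (u y) (v z) + rt' (v y) (u z) + f' (v y) (v z)
                 - map_poly u (c y z))"

definition ext_equiv :: "(complex poly \<Rightarrow> 'a::ab_group_add \<Rightarrow> 'a) \<Rightarrow> ('a \<Rightarrow> 'a \<Rightarrow> 'a poly) \<Rightarrow>
    (complex poly \<Rightarrow> 'q::ab_group_add \<Rightarrow> 'q) \<Rightarrow> ('a, 'q) ext_datum rel" where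
  "ext_equiv sA m sQ =
     {(\<Omega>, \<Omega>'). \<Omega> \<in> TC sA m sQ \<and> \<Omega>' \<in> TC sA m sQ \<and>
        (\<exists>u v. module_hom sQ sA u \<and> module_hom sQ sQ v \<and> bij v \<and> ext_related m u v \<Omega> \<Omega>')}"

definition ext_cohom :: "(complex poly \<Rightarrow> 'a::ab_group_add \<Rightarrow> 'a) \<Rightarrow> ('a \<Rightarrow> 'a \<Rightarrow> 'a poly) \<Rightarrow>
    (complex poly \<Rightarrow> 'q::ab_group_add \<Rightarrow> 'q) \<Rightarrow> ('a, 'q) ext_datum rel" where
  "ext_cohom sA m sQ =
     {(\<Omega>, \<Omega>'). \<Omega> \<in> TC sA m sQ \<and> \<Omega>' \<in> TC sA m sQ \<and>
        (\<exists>u. module_hom sQ sA u \<and> ext_related m u id \<Omega> \<Omega>')}"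

text \<open>\<open>AH2_A\<close> and \<open>AH2\<close> are the quotients of \<open>TC\<close> by \<open>\<equiv>\<close> and \<open>\<approx>\<close>, respectively.\<close>

definition AH2_A where
  "AH2_A sA m sQ = TC sA m sQ // ext_equiv sA m sQ"

definition AH2 where
  "AH2 sA m sQ = TC sA m sQ // ext_cohom sA m sQ"


section \<open>Flag datums\<close>

type_synonym 'a flag =
  "('a \<Rightarrow> complex poly poly) \<times> ('a \<Rightarrow> 'a poly) \<times> ('a \<Rightarrow> complex poly poly) \<times> ('a \<Rightarrow> 'a poly) \<times>
   'a poly \<times> complex poly poly"

definition FAC :: "(complex poly \<Rightarrow> 'a::ab_group_add \<Rightarrow> 'a) \<Rightarrow> ('a \<Rightarrow> 'a \<Rightarrow> 'a poly) \<Rightarrow> 'a set \<Rightarrow>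
    'a flag set" where
  "FAC s m V = {(h, D, g, T, Q0, P).
     left_conformal_linear s (*) h \<and> left_conformal_linear s s D \<and>
     conformal_linear s (*) g \<and> conformal_linear s s T \<and>
     (\<forall>a\<in>V. \<forall>b\<in>V.
       app_at s D (lam + mu) (subst_at s (m a b) lam)
         = app_at s (m a) lam (subst_at s (D b) mu)
           + poly_scale2 s (coef_at (h b) mu (lam + pd2)) (subst_at s (D a) lam) \<and>
       coef_at (h b) mu (lam + pd2) * coef_at (h a) lam pd2
         = app_at (*) h (lam + mu) (subst_at s (m a b) lam) \<and>
       app_at s (m a) lam (subst_at s (T b) mu)
           + poly_scale2 s (coef_at (g b) mu (lam + pd2)) (subst_at s (D a) lam)
         = app_at s (\<lambda>d. m d b) (lam + mu) (subst_at s (D a) lam)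
           + poly_scale2 s (coef_at (h a) lam (- lam - mu)) (subst_at s (T b) (lam + mu)) \<and>
       coef_at (g b) mu (lam + pd2) * coef_at (h a) lam pd2
         = coef_at (h a) lam (- lam - mu) * coef_at (g b) (lam + mu) pd2 \<and>
       app_at s T lam (subst_at s (m a b) mu)
         = app_at s (\<lambda>d. m d b) (lam + mu) (subst_at s (T a) lam)
           + poly_scale2 s (coef_at (g a) lam (- lam - mu)) (subst_at s (T b) (lam + mu)) \<and>
       app_at (*) g lam (subst_at s (m a b) mu)
         = coef_at (g a) lam (- lam - mu) * coef_at (g b) (lam + mu) pd2) \<and>
     (\<forall>a\<in>V.
       poly_scale2 s (coef_at P mu (lam + pd2)) (subst_at s (D a) lam)
         = app_at s D (lam + mu) (subst_at s (D a) lam)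
           + poly_scale2 s (coef_at (h a) lam (- lam - mu)) (subst_at s Q0 (lam + mu))
           - app_at s (m a) lam (subst_at s Q0 mu) \<and>
       coef_at P mu (lam + pd2) * coef_at (h a) lam pd2
         = coef_at (h a) lam (- lam - mu) * coef_at P (lam + mu) pd2
           + app_at (*) h (lam + mu) (subst_at s (D a) lam) \<and>
       app_at s T lam (subst_at s (D a) mu)
           + poly_scale2 s (coef_at (h a) mu (lam + pd2)) (subst_at s Q0 lam)
         = app_at s D (lam + mu) (subst_at s (T a) lam)
           + poly_scale2 s (coef_at (g a) lam (- lam - mu)) (subst_at s Q0 (lam + mu)) \<and>
       app_at (*) g lam (subst_at s (D a) mu)
           + coef_at (h a) mu (lam + pd2) * coef_at P lam pd2
         = app_at (*) h (lam + mu) (subst_at s (T a) lam)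
           + coef_at (g a) lam (- lam - mu) * coef_at P (lam + mu) pd2 \<and>
       app_at s T lam (subst_at s (T a) mu)
           + poly_scale2 s (coef_at (g a) mu (lam + pd2)) (subst_at s Q0 lam)
         = app_at s (\<lambda>d. m d a) (lam + mu) (subst_at s Q0 lam)
           + poly_scale2 s (coef_at P lam (- lam - mu)) (subst_at s (T a) (lam + mu)) \<and>
       app_at (*) g lam (subst_at s (T a) mu)
           + coef_at (g a) mu (lam + pd2) * coef_at P lam pd2
         = coef_at P lam (- lam - mu) * coef_at (g a) (lam + mu) pd2) \<and>
     app_at s T lam (subst_at s Q0 mu)
         + poly_scale2 s (coef_at P mu (lam + pd2)) (subst_at s Q0 lam)
       = app_at s D (lam + mu) (subst_at s Q0 lam)
         + poly_scale2 s (coef_at P lam (- lam - mu)) (subst_at s Q0 (lam + mu)) \<and>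
     app_at (*) g lam (subst_at s Q0 mu)
         + coef_at P mu (lam + pd2) * coef_at P lam pd2
       = app_at (*) h (lam + mu) (subst_at s Q0 lam)
         + coef_at P lam (- lam - mu) * coef_at P (lam + mu) pd2}"

text \<open>
  The \<open>\<lambda>\<close>-product of \<open>AC(A, C[\<partial>]x | \<dots>)\<close>. The definite description is meaningful
  because \<open>V\<close> generates \<open>A\<close> and \<open>x\<close> is a free generator of \<open>Q\<close>.
\<close>

definition AC :: "(complex poly \<Rightarrow> 'a::ab_group_add \<Rightarrow> 'a) \<Rightarrow> ('a \<Rightarrow> 'a \<Rightarrow> 'a poly) \<Rightarrow> 'a set \<Rightarrow>
    (complex poly \<Rightarrow> 'q::ab_group_add \<Rightarrow> 'q) \<Rightarrow> 'q \<Rightarrow> 'a flag \<Rightarrow>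
    'a \<times> 'q \<Rightarrow> 'a \<times> 'q \<Rightarrow> ('a \<times> 'q) poly" where
  "AC sA m V sQ x = (\<lambda>(h, D, g, T, Q0, P).
     let times_x = map_poly (\<lambda>r. sQ r x) in
     THE M. conformal_bilinear (sum_scale sA sQ) (sum_scale sA sQ) (sum_scale sA sQ) M \<and>
       (\<forall>a\<in>V. \<forall>b\<in>V. M (a, 0) (b, 0) = pair_poly (m a b) 0) \<and>
       M (0, x) (0, x) = pair_poly Q0 (times_x P) \<and>
       (\<forall>a\<in>V. M (a, 0) (0, x) = pair_poly (D a) (times_x (h a))) \<and>
       (\<forall>a\<in>V. M (0, x) (a, 0) = pair_poly (T a) (times_x (g a))))"

definition flag_related :: "(complex poly \<Rightarrow> 'a::ab_group_add \<Rightarrow> 'a) \<Rightarrow> ('a \<Rightarrow> 'a \<Rightarrow> 'a poly) \<Rightarrow>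
    'a \<Rightarrow> complex \<Rightarrow> 'a flag \<Rightarrow> 'a flag \<Rightarrow> bool" where
  "flag_related s m T0 \<beta> = (\<lambda>(h, D, g, T, Q0, P) (h', D', g', T', Q0', P').
     h = h' \<and> g = g' \<and>
     (\<forall>a. D a = m a T0 + complex_poly_scale s \<beta> (D' a) - poly_scale s (h a) [:T0:]) \<and>
     (\<forall>a. T a = m T0 a + complex_poly_scale s \<beta> (T' a) - poly_scale s (g a) [:T0:]) \<and>
     P = h' T0 + g' T0 + smult [:\<beta>:] P' \<and>
     Q0 = m T0 T0 + complex_poly_scale s \<beta> (D' T0) + complex_poly_scale s \<beta> (T' T0)
            + complex_poly_scale s (\<beta>\<^sup>2) Q0' - poly_scale s P [:T0:])"

definition flag_equiv :: "(complex poly \<Rightarrow> 'a::ab_group_add \<Rightarrow> 'a) \<Rightarrow> ('a \<Rightarrow> 'a \<Rightarrow> 'a poly) \<Rightarrow>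
    'a set \<Rightarrow> 'a flag rel" where
  "flag_equiv s m V = {(d, d'). d \<in> FAC s m V \<and> d' \<in> FAC s m V \<and>
     (\<exists>T0 \<beta>. \<beta> \<noteq> 0 \<and> flag_related s m T0 \<beta> d d')}"

definition flag_cohom :: "(complex poly \<Rightarrow> 'a::ab_group_add \<Rightarrow> 'a) \<Rightarrow> ('a \<Rightarrow> 'a \<Rightarrow> 'a poly) \<Rightarrow>
    'a set \<Rightarrow> 'a flag rel" where
  "flag_cohom s m V = {(d, d'). d \<in> FAC s m V \<and> d' \<in> FAC s m V \<and>
     (\<exists>T0. flag_related s m T0 1 d d')}"

end

theory Submission
  imports Defs
begin

text \<open>
  All maps in the statement are semilinear: they are \<open>C[\<partial>]\<close>-module homomorphisms into a polynomial
  module on which \<open>C[\<partial>]\<close> acts through a substitution, \<open>\<partial> \<mapsto> -\<lambda>\<close> in the left argument and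
  \<open>\<partial> \<mapsto> \<partial> + \<lambda>\<close> in the right one. The two sides of the associativity law are semilinear in each of
  the three arguments, for the same substitutions \<open>-\<lambda>\<close>, \<open>-\<mu>\<close> and \<open>\<partial> + \<lambda> + \<mu>\<close>, so associativity need
  only be checked on generators; on \<open>V\<close> and \<open>x\<close> it becomes the fourteen flag conditions. An
  isomorphism stabilizing \<open>A\<close> has the form \<open>(a, y) \<mapsto> (a + u(y), v(y))\<close>; it is given by \<open>T\<^sub>0 = u(x)\<close>
  and \<open>v(x)\<close>, and bijectivity forces \<open>v(x) = \<beta> x\<close> with \<open>\<beta>\<close> a unit of \<open>C[\<partial>]\<close>, that is, a nonzero
  constant. Comparing products of generators then gives the relation on flags.
\<close>

section \<open>Additive maps on polynomials\<close>

text \<open>Two obstacles shape the argument. In a nested product a scalar passes through two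
  substitutions, and \<open>app_at\<close> sees its argument only after the inner substitution has
  been carried out. \<open>comp_at\<close> keeps the inner polynomial and its substitution apart,
  which gives a single law for moving scalars; all shifted arguments \<lambda>+\<partial> and
  -\<lambda>-\<mu> of the flag conditions come from it. Secondly, extending structures and flags are
  never compared directly. Both \<open>ext_product m\<close> and \<open>AC\<close> are bijections
  onto the set of algebra structures on A \<oplus> Q, and each carries its own relation to
  isomorphism of structures. Only isomorphism is checked to be an equivalence, by inverting and
  composing maps; for flags this is transported, which avoids manipulating the formulas in
  \<open>T0\<close> and \<beta>. The definite description in \<open>AC\<close> is resolved by an
  explicit formula, \<open>flag_product\<close>, in the coordinate of Q with respect to x.\<close>

lemma poly_monom_induct [case_names monom add]:
  fixes w :: "'a::ab_group_add poly"
  assumes monom: "\<And>a n. P (monom a n)" and add: "\<And>u v. P u \<Longrightarrow> P v \<Longrightarrow> P (u + v)"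
  shows "P w"
proof -
  \<comment> \<open>The empty sum is covered by \<open>monom 0 0\<close>, the zero
    polynomial.\<close>
  have "P (\<Sum>i\<in>I. monom (coeff w i) i)" if "finite I" for I
    using that by induction (use assms monom[of 0 0] in auto)
  from this[of "{..degree w}"] show ?thesis
    by (simp add: poly_as_sum_of_monoms)
qed

text \<open>The degree is not additive, so the sums defining \<open>poly_scale\<close>,
  \<open>subst_at\<close> and \<open>comp_at\<close> are not visibly additive either. Additive
  summands vanish on zero coefficients, so the bound can be raised until two polynomials and their
  sum share it.\<close>

lemma sum_degree_extend:
  fixes G :: "nat \<Rightarrow> 'a::ab_group_add \<Rightarrow> 'b::ab_group_add"
  assumes "\<And>n. additive (G n)" "degree w \<le> N"
  shows "(\<Sum>n\<le>degree w. G n (coeff w n)) = (\<Sum>n\<le>N. G n (coeff w n))"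
  by (rule sum.mono_neutral_left)
    (use assms in \<open>auto simp: additive.zero coeff_eq_0\<close>)

lemma sum_degree_add:
  fixes G :: "nat \<Rightarrow> 'a::ab_group_add \<Rightarrow> 'b::ab_group_add"
  assumes "\<And>n. additive (G n)"
  shows "(\<Sum>n\<le>degree (u + v). G n (coeff (u + v) n)) =
    (\<Sum>n\<le>degree u. G n (coeff u n)) + (\<Sum>n\<le>degree v. G n (coeff v n))"
proof -
  let ?N = "max (degree u) (degree v)"
  have "(\<Sum>n\<le>degree w. G n (coeff w n)) = (\<Sum>n\<le>?N. G n (coeff w n))"
    if "degree w \<le> ?N" for w
    by (rule sum_degree_extend[OF assms that])
  from this[of u] this[of v] this[of "u + v"] show ?thesis
    by (simp add: degree_add_le sum.distrib additive.add[OF assms])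
qed

lemma sum_degree_monom:
  fixes G :: "nat \<Rightarrow> 'a::ab_group_add \<Rightarrow> 'b::ab_group_add"
  assumes "\<And>n. additive (G n)"
  shows "(\<Sum>i\<le>degree (monom a n). G i (coeff (monom a n) i)) = G n a"
proof -
  have "(\<Sum>i\<le>n. G i (coeff (monom a n) i)) = (\<Sum>i\<in>{n}. G i (coeff (monom a n) i))"
    by (rule sum.mono_neutral_right) (use assms in \<open>auto simp: additive.zero\<close>)
  then show ?thesis
    by (simp add: sum_degree_extend[of G "monom a n" n, OF assms degree_monom_le]
        del: coeff_monom) simp
qed

lemma map_poly_add:
  fixes f :: "'a::ab_group_add \<Rightarrow> 'b::ab_group_add"
  assumes "additive f"
  shows "map_poly f (u + v) = map_poly f u + map_poly f v"
  by (intro poly_eqI) (simp add: coeff_map_poly assms additive.zero additive.add)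

lemma additive_map_poly:
  fixes f :: "'a::ab_group_add \<Rightarrow> 'b::ab_group_add"
  shows "additive f \<Longrightarrow> additive (map_poly f)"
  by (intro additive.intro) (simp add: map_poly_add)

section \<open>Evaluation homomorphisms\<close>

locale comm_ring_hom_map =
  fixes \<phi> :: "'a::comm_ring_1 \<Rightarrow> 'b::comm_ring_1"
  assumes hom_add: "\<phi> (a + b) = \<phi> a + \<phi> b"
    and hom_mult: "\<phi> (a * b) = \<phi> a * \<phi> b"
    and hom_one: "\<phi> 1 = 1"
begin

lemma additive: "additive \<phi>"
  by (intro additive.intro hom_add)

lemma eval_add: "poly (map_poly \<phi> (p + q)) X = poly (map_poly \<phi> p) X + poly (map_poly \<phi> q) X"
  by (simp add: map_poly_add additive)

lemma eval_monom: "poly (map_poly \<phi> (monom a n)) X = \<phi> a * X ^ n"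
  by (simp add: map_poly_monom additive.zero[OF additive] poly_monom)

lemma eval_mult: "poly (map_poly \<phi> (p * q)) X = poly (map_poly \<phi> p) X * poly (map_poly \<phi> q) X"
proof (induction p rule: poly_monom_induct)
  case (monom a n)
  show ?case
    by (induction q rule: poly_monom_induct)
      (simp_all add: eval_monom mult_monom hom_mult power_add eval_add algebra_simps)
qed (simp add: eval_add algebra_simps)

text \<open>The construction can be iterated: constants as coefficient map give \<open>ev1\<close>
  and \<open>ev2\<close>, and \<open>ev2\<close> as coefficient map gives
  \<open>coef_at\<close>.\<close>

lemma comm_ring_hom_map_eval: "comm_ring_hom_map (\<lambda>p. poly (map_poly \<phi> p) X)"
  by unfold_locales (auto simp: eval_add eval_mult hom_one)

end

text \<open>The algebra homomorphism on C[\<partial>] with \<partial> \<mapsto> X. It describes what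
  becomes of a scalar that is moved out of a \<lambda>-product; \<open>ev2\<close> does the same in
  two variables.\<close>

definition ev1 :: "complex poly poly \<Rightarrow> complex poly \<Rightarrow> complex poly poly" where
  "ev1 X r = poly (map_poly (\<lambda>c. [:[:c:]:]) r) X"

definition ev2 :: "complex poly poly poly \<Rightarrow> complex poly \<Rightarrow> complex poly poly poly" where
  "ev2 X r = poly (map_poly (\<lambda>c. [:[:[:c:]:]:]) r) X"

lemma coef_at_ev2: "coef_at h X Y = poly (map_poly (ev2 Y) h) X"
  by (simp add: coef_at_def ev2_def[abs_def])

interpretation const1: comm_ring_hom_map "\<lambda>c::complex. [:[:c:]:]"
  by unfold_locales (auto simp: one_pCons)

interpretation const2: comm_ring_hom_map "\<lambda>c::complex. [:[:[:c:]:]:]"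
  by unfold_locales (auto simp: one_pCons)

interpretation ev1: comm_ring_hom_map "ev1 X" for X
  unfolding ev1_def[abs_def] by (rule const1.comm_ring_hom_map_eval)

interpretation ev2: comm_ring_hom_map "ev2 X" for X
  unfolding ev2_def[abs_def] by (rule const2.comm_ring_hom_map_eval)

interpretation coef_at: comm_ring_hom_map "\<lambda>h. coef_at h X Y" for X Y
  unfolding coef_at_ev2[abs_def] by (rule ev2.comm_ring_hom_map_eval)

lemma ev1_monom: "ev1 X (monom c n) = [:[:c:]:] * X ^ n"
  unfolding ev1_def by (rule const1.eval_monom)

lemma ev2_monom: "ev2 X (monom c n) = [:[:[:c:]:]:] * X ^ n"
  unfolding ev2_def by (rule const2.eval_monom)

lemma coef_at_monom: "coef_at (monom r n) X Y = ev2 Y r * X ^ n"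
  unfolding coef_at_ev2 by (rule ev2.eval_monom)

lemma ev1_const: "ev1 X [:c:] = [:[:c:]:]"
  using ev1_monom[of X c 0] by (simp add: monom_0)

lemma ev2_const: "ev2 X [:c:] = [:[:[:c:]:]:]"
  using ev2_monom[of X c 0] by (simp add: monom_0)

lemma ev1_pd: "ev1 X pd = X"
  using ev1_monom[of X 1 1] by (simp add: pd_def monom_Suc monom_0 flip: one_pCons)

lemma ev2_pd: "ev2 X pd = X"
  using ev2_monom[of X 1 1] by (simp add: pd_def monom_Suc monom_0 flip: one_pCons)

lemma coef_at_const: "coef_at [:r:] X Y = ev2 Y r"
  using coef_at_monom[of r 0] by (simp add: monom_0)

lemma coef_at_lam1: "coef_at lam1 X Y = X"
  using coef_at_monom[of 1 1] by (simp add: lam1_def monom_Suc monom_0 ev2.hom_one)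

lemma coef_at_pd1: "coef_at pd1 X Y = Y"
  by (simp add: pd1_def coef_at_const ev2_pd)

lemma coef_at_neg_lam1: "coef_at (- lam1) X Y = - X"
  by (simp add: additive.minus[OF coef_at.additive] coef_at_lam1)

lemma coef_at_pd1_lam1: "coef_at (pd1 + lam1) X Y = Y + X"
  by (simp add: coef_at.hom_add coef_at_lam1 coef_at_pd1)

text \<open>\<open>pd2\<close> is the derivation itself, so substituting it amounts to the embedding
  of C[\<partial>] as constants in \<lambda> and \<mu>.\<close>

lemma ev2_pd2: "ev2 pd2 r = [:[:r:]:]"
proof (induction r rule: poly_monom_induct)
  case (monom c n)
  have "[:[:c:]:] * pd1 ^ n = [:[:c:] * pd ^ n:]" for n
    by (induction n) (simp_all add: pd1_def mult.left_commute)
  moreover have "ev2 pd2 (monom c n) = [:[:[:c:]:] * pd1 ^ n:]"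
    by (induction n) (simp_all add: ev2_monom pd2_def mult.left_commute)
  ultimately show ?case
    by (simp add: pd_def monom_altdef)
qed (simp add: ev2.hom_add)

text \<open>Two substitutions composed: \<partial> \<mapsto> Z, then \<lambda> \<mapsto> X and
  \<partial> \<mapsto> Y inside Z. It computes how twists of nested products combine.\<close>

lemma coef_at_ev1: "coef_at (ev1 Z r) X Y = ev2 (coef_at Z X Y) r"
proof (induction r rule: poly_monom_induct)
  case (monom c n)
  have "coef_at (Z ^ n) X Y = coef_at Z X Y ^ n"
    by (induction n) (simp_all add: coef_at.hom_mult coef_at.hom_one)
  then show ?case
    by (simp only: ev1_monom ev2_monom coef_at.hom_mult coef_at_const ev2_const)
qed (simp add: ev1.hom_add ev2.hom_add coef_at.hom_add)

section \<open>Polynomials over modules\<close>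

context module
begin

lemma additive_scale: "additive (scale r)"
  by (intro additive.intro) (rule scale_right_distrib)

lemma poly_scale_left_add: "poly_scale scale (p + q) w = poly_scale scale p w +
    poly_scale scale q w"
  unfolding poly_scale_def
  by (rule sum_degree_add)
    (auto intro!: additive.intro simp: scale_left_distrib sum.distrib add_monom[symmetric])

lemma poly_scale_right_add: "poly_scale scale p (v + w) = poly_scale scale p v +
    poly_scale scale p w"
proof -
  have "(\<Sum>j\<le>degree (v + w). monom (scale r (coeff (v + w) j)) (i + j)) =
      (\<Sum>j\<le>degree v. monom (scale r (coeff v j)) (i + j)) +
      (\<Sum>j\<le>degree w. monom (scale r (coeff w j)) (i + j))" for r i
    by (rule sum_degree_add) (simp add: additive.intro scale_right_distrib flip: add_monom)
  then show ?thesis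
    unfolding poly_scale_def by (simp only: sum.distrib)
qed

lemma poly_scale_monom: "poly_scale scale (monom r i) (monom a j) = monom (scale r a) (i + j)"
proof -
  have "poly_scale scale (monom r i) (monom a j) =
      (\<Sum>j'\<le>degree (monom a j). monom (scale r (coeff (monom a j) j')) (i + j'))"
    unfolding poly_scale_def
    by (rule sum_degree_monom)
      (auto intro!: additive.intro simp: scale_left_distrib sum.distrib add_monom[symmetric])
  also have "\<dots> = monom (scale r a) (i + j)"
    by (rule sum_degree_monom)
      (auto intro!: additive.intro simp: scale_right_distrib add_monom[symmetric])
  finally show ?thesis .
qed

lemma poly_scale_assoc: "poly_scale scale (p * q) w = poly_scale scale p (poly_scale scale q w)"
proof (induction p rule: poly_monom_induct)
  case (monom r i)
  show ?case
  proof (induction q rule: poly_monom_induct)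
    case (monom r' i')
    show ?case
      by (induction w rule: poly_monom_induct)
        (simp_all add: mult_monom poly_scale_monom poly_scale_right_add add.assoc)
  qed (simp add: poly_scale_left_add poly_scale_right_add distrib_left)
qed (simp add: poly_scale_left_add distrib_right)

lemma poly_scale_const_monom: "poly_scale scale [:r:] (monom a n) = monom (scale r a) n"
  using poly_scale_monom[of r 0] by (simp add: monom_0)

lemma poly_scale_const: "poly_scale scale [:r:] w = map_poly (scale r) w"
  by (induction w rule: poly_monom_induct)
    (simp_all add: poly_scale_right_add poly_scale_const_monom map_poly_monom map_poly_add
        additive_scale)

lemma poly_scale_one: "poly_scale scale 1 w = w"
proof -
  have "poly_scale scale [:1:] w = w"
    unfolding poly_scale_const by (intro poly_eqI) (simp add: coeff_map_poly)
  then show ?thesis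
    by (simp add: one_pCons)
qed

lemma module_poly_scale: "module (poly_scale scale)"
  by unfold_locales
    (simp_all add: poly_scale_left_add poly_scale_right_add poly_scale_assoc poly_scale_one)

end

lemma module_mult: "module ((*) :: 'a::comm_ring_1 \<Rightarrow> 'a \<Rightarrow> 'a)"
  by unfold_locales (simp_all add: algebra_simps)

text \<open>Makes C[\<partial>] an instance of the general theory, so that statements about A-valued
  maps also apply to h, g and P.\<close>

lemma poly_scale_mult: "poly_scale (*) = ((*) :: 'a::comm_ring_1 poly \<Rightarrow> 'a poly \<Rightarrow> 'a poly)"
proof (intro ext)
  fix p q :: "'a poly"
  interpret module "(*) :: 'a \<Rightarrow> 'a \<Rightarrow> 'a" by (rule module_mult)
  show "poly_scale (*) p q = p * q"
  proof (induction p rule: poly_monom_induct)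
    case (monom r i)
    show ?case
      by (induction q rule: poly_monom_induct)
        (simp_all add: mult_monom poly_scale_monom poly_scale_right_add distrib_left)
  qed (simp add: poly_scale_left_add distrib_right)
qed

lemma module_hom_additive: "module_hom s t f \<Longrightarrow> additive f"
  by (intro additive.intro) (rule module_hom.add)

lemma map_poly_poly_scale:
  assumes "module_hom s t f"
  shows "map_poly f (poly_scale s p w) = poly_scale t p (map_poly f w)"
proof -
  interpret module_hom s t f by fact
  have f: "additive f" by (intro additive.intro add)
  show ?thesis
  proof (induction p rule: poly_monom_induct)
    case (monom r i)
    show ?case
      by (induction w rule: poly_monom_induct)
        (simp_all add: m1.poly_scale_monom m2.poly_scale_monom map_poly_monom scale
          m1.poly_scale_right_add m2.poly_scale_right_add map_poly_add f)
  qed (simp add: m1.poly_scale_left_add m2.poly_scale_left_add map_poly_add f)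
qed

lemma module_hom_map_poly:
  assumes "module_hom s t f"
  shows "module_hom (poly_scale s) (poly_scale t) (map_poly f)"
  using assms module_hom.axioms(1,2)[OF assms]
  by (auto simp: module_hom_iff map_poly_poly_scale map_poly_add additive.intro
      module.module_poly_scale)

section \<open>Substitution and composition\<close>

locale cmodule = module s for s :: "complex poly \<Rightarrow> 'a::ab_group_add \<Rightarrow> 'a"
begin

sublocale p: module "poly_scale s"
  by (rule module_poly_scale)

sublocale pp: module "poly_scale2 s"
  by (rule p.module_poly_scale)

lemma poly_scale2_const_add:
  "poly_scale2 s q [:[:u + v:]:] = poly_scale2 s q [:[:u:]:] + poly_scale2 s q [:[:v:]:]"
  by (simp flip: pp.scale_right_distrib)

lemma subst_at_add: "subst_at s (v + w) X = subst_at s v X + subst_at s w X"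
  unfolding subst_at_def
  by (rule sum_degree_add)
    (auto intro!: additive.intro simp: poly_scale2_const_add)

lemma additive_subst_at: "additive (\<lambda>w. subst_at s w X)"
  by (intro additive.intro) (rule subst_at_add)

lemma subst_at_0 [simp]: "subst_at s 0 X = 0"
  by (rule additive.zero[OF additive_subst_at])

lemma subst_at_monom: "subst_at s (monom a n) X = poly_scale2 s (X ^ n) [:[:a:]:]"
  unfolding subst_at_def
  by (rule sum_degree_monom)
    (auto intro!: additive.intro simp: poly_scale2_const_add)

lemma poly_scale2_const: "poly_scale2 s [:[:r:]:] [:[:a:]:] = [:[:s r a:]:]"
  using p.poly_scale_monom[of "[:r:]" 0 "[:a:]" 0] poly_scale_monom[of r 0 a 0]
  by (simp add: monom_0)

lemma subst_at_poly_scale: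
  "subst_at s (poly_scale s p w) X = poly_scale2 s (coef_at p X pd2) (subst_at s w X)"
proof (induction p rule: poly_monom_induct)
  case (monom r i)
  show ?case
  proof (induction w rule: poly_monom_induct)
    case (monom a j)
    have "poly_scale2 s (X ^ (i + j)) [:[:s r a:]:] =
        poly_scale2 s (X ^ (i + j)) (poly_scale2 s [:[:r:]:] [:[:a:]:])"
      by (simp add: poly_scale2_const)
    also have "\<dots> = poly_scale2 s ([:[:r:]:] * X ^ i) (poly_scale2 s (X ^ j) [:[:a:]:])"
      by (simp only: pp.scale_scale) (simp only: power_add mult_ac)
    finally show ?case
      by (simp only: poly_scale_monom subst_at_monom coef_at_monom ev2_pd2)
  qed (simp add: p.scale_right_distrib pp.scale_right_distrib subst_at_add)
qed (simp add: p.scale_left_distrib pp.scale_left_distrib subst_at_add coef_at.hom_add)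

end

text \<open>\<open>comp_at s F X w Y\<close> is \<open>F\<^sub>X(w\<^sub>Y)\<close> for \<open>w\<close> in \<open>U[\<lambda>]\<close>. Unlike \<^const>\<open>app_at\<close>, it commutes
  with multiplication of \<open>w\<close> by polynomials for every \<open>Y\<close>.\<close>

definition comp_at :: "(complex poly \<Rightarrow> 'a::ab_group_add \<Rightarrow> 'a) \<Rightarrow> ('u::zero \<Rightarrow> 'a poly) \<Rightarrow>
    complex poly poly poly \<Rightarrow> 'u poly \<Rightarrow> complex poly poly poly \<Rightarrow> 'a poly poly" where
  "comp_at s F X w Y = (\<Sum>n\<le>degree w. poly_scale2 s (Y ^ n) (subst_at s (F (coeff w n)) X))"

context cmodule
begin

lemma additive_comp_aux:
  assumes "additive F"
  shows "additive (\<lambda>u. poly_scale2 s Z (subst_at s (F u) X))"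
  by (intro additive.intro)
    (simp add: additive.add[OF assms] subst_at_add pp.scale_right_distrib)

lemma comp_at_add: "additive F \<Longrightarrow> comp_at s F X (v + w) Y = comp_at s F X v Y + comp_at s F X w Y"
  unfolding comp_at_def by (rule sum_degree_add) (rule additive_comp_aux)

lemma comp_at_monom:
  "additive F \<Longrightarrow> comp_at s F X (monom u n) Y = poly_scale2 s (Y ^ n) (subst_at s (F u) X)"
  unfolding comp_at_def by (rule sum_degree_monom) (rule additive_comp_aux)

lemma comp_at_fun_add:
  "comp_at s (\<lambda>u. F u + G u) X w Y = comp_at s F X w Y + comp_at s G X w Y"
  by (simp add: comp_at_def subst_at_add pp.scale_right_distrib sum.distrib)

lemma comp_at_fun_0 [simp]: "comp_at s (\<lambda>u. 0) X w Y = 0"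
  by (simp add: comp_at_def)

lemma comp_at_fun_poly_scale:
  "comp_at s (\<lambda>u. poly_scale s p (F u)) X w Y = poly_scale2 s (coef_at p X pd2) (comp_at s F X w Y)"
  by (simp add: comp_at_def subst_at_poly_scale pp.scale_sum_right mult.commute)

text \<open>The restriction on Y matters: if Y involved \<open>pd2\<close>, the derivation would act
  on the argument before F is applied and would be twisted by F, whereas \<open>comp_at\<close>
  multiplies by Y outside F.\<close>

lemma app_at_subst_at:
  fixes s' :: "complex poly \<Rightarrow> 'u::ab_group_add \<Rightarrow> 'u"
  assumes "cmodule s'" and F: "additive F" and Y: "Y = lam \<or> Y = mu"
  shows "app_at s F X (subst_at s' w Y) = comp_at s F X w Y"
proof -
  interpret U: cmodule s' by fact
  define G where "G i v = (\<Sum>j\<le>degree v.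
     poly_scale2 s (mu ^ i * lam ^ j) (subst_at s (F (coeff v j)) X))" for i v
  have aux: "additive (\<lambda>u. poly_scale2 s Z (subst_at s (F u) X))" for Z
    by (rule additive_comp_aux[OF F])
  have G: "additive (G i)" for i
    unfolding G_def by (intro additive.intro sum_degree_add aux)
  have G_monom: "G i (monom u j) = poly_scale2 s (mu ^ i * lam ^ j) (subst_at s (F u) X)" for i j u
    unfolding G_def by (intro sum_degree_monom aux)
  have app: "app_at s F X u = (\<Sum>i\<le>degree u. G i (coeff u i))" for u
    by (simp add: app_at_def G_def)
  have add: "app_at s F X (u + v) = app_at s F X u + app_at s F X v" for u v
    unfolding app by (intro sum_degree_add G)
  have app_monom: "app_at s F X (monom (monom u j) i) =
      poly_scale2 s (mu ^ i * lam ^ j) (subst_at s (F u) X)" for u i j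
    using sum_degree_monom[of G "monom u j" i, OF G] by (simp only: app G_monom)
  \<comment> \<open>\<open>mu\<close> is the outer and \<open>lam\<close> the inner variable, so
    either substitution merely places the coefficients of w in one of the two degrees, and
    \<open>app_at\<close> reads them back unchanged.\<close>
  have mu: "poly_scale2 s' (mu ^ n) [:[:u:]:] = monom (monom u 0) n" for n u
  proof -
    have "mu ^ n = monom 1 n"
      by (simp add: mu_def monom_altdef)
    then show ?thesis
      using U.p.poly_scale_monom[of 1 n "[:u:]" 0] by (simp add: monom_0)
  qed
  have lam: "poly_scale2 s' (lam ^ n) [:[:u:]:] = monom (monom u n) 0" for n u
  proof -
    have "lam ^ n = [:lam1 ^ n:]"
      by (induction n) (simp_all add: lam_def one_pCons)
    moreover have "lam1 ^ n = monom 1 n"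
      by (simp add: lam1_def monom_altdef)
    moreover have "poly_scale s' (monom 1 n) [:u:] = monom u n"
      using U.poly_scale_monom[of 1 n u 0] by (simp add: monom_0)
    ultimately show ?thesis
      using U.p.poly_scale_const_monom[of "monom 1 n" "[:u:]" 0] by (simp add: monom_0)
  qed
  show ?thesis
    by (induction w rule: poly_monom_induct)
      (use Y in \<open>auto simp: U.subst_at_add add comp_at_add[OF F] comp_at_monom[OF F]
        U.subst_at_monom mu lam app_monom\<close>)
qed

end

section \<open>Semilinear maps\<close>

text \<open>Restriction of scalars along \<open>ev1 Z\<close>. It makes the library of
  \<open>module_hom\<close>, above all agreement on a spanning set, available for conformal
  maps.\<close>

definition twist :: "complex poly poly \<Rightarrow> (complex poly \<Rightarrow> 'a::ab_group_add \<Rightarrow> 'a) \<Rightarrow>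
    complex poly \<Rightarrow> 'a poly \<Rightarrow> 'a poly" where
  "twist Z s r = poly_scale s (ev1 Z r)"

definition twist2 :: "complex poly poly poly \<Rightarrow> (complex poly \<Rightarrow> 'a::ab_group_add \<Rightarrow> 'a) \<Rightarrow>
    complex poly \<Rightarrow> 'a poly poly \<Rightarrow> 'a poly poly" where
  "twist2 Z s r = poly_scale2 s (ev2 Z r)"

abbreviation semilinear :: "complex poly poly \<Rightarrow> (complex poly \<Rightarrow> 'u::ab_group_add \<Rightarrow> 'u) \<Rightarrow>
    (complex poly \<Rightarrow> 'a::ab_group_add \<Rightarrow> 'a) \<Rightarrow> ('u \<Rightarrow> 'a poly) \<Rightarrow> bool" where
  "semilinear Z s t \<equiv> module_hom s (twist Z t)"

lemma (in comm_ring_hom_map) module_restrict: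
  assumes "module s"
  shows "module (\<lambda>r. s (\<phi> r))"
proof -
  interpret module s by fact
  show ?thesis
    by unfold_locales
      (simp_all add: scale_left_distrib scale_right_distrib hom_add hom_mult hom_one)
qed

context cmodule
begin

lemma module_twist: "module (twist Z s)"
  unfolding twist_def[abs_def] by (rule ev1.module_restrict) unfold_locales

lemma module_twist2: "module (twist2 Z s)"
  unfolding twist2_def[abs_def] by (rule ev2.module_restrict) unfold_locales

lemma vector_space_complex_scale: "vector_space (complex_scale s)"
  unfolding module_iff_vector_space[symmetric]
  by unfold_locales
    (simp_all add: complex_scale_def scale_right_distrib mult.commute
      flip: scale_left_distrib one_pCons)

lemma vector_space_complex_poly_scale: "vector_space (complex_poly_scale s)"
  unfolding module_iff_vector_space[symmetric]
  by unfold_locales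
    (simp_all add: complex_poly_scale_def p.scale_right_distrib mult.commute
      flip: p.scale_left_distrib one_pCons)

text \<open>The \<lambda> of the scalar p becomes Y, while F turns its \<partial> into Z, which is
  then read at X. For Z = \<open>pd1 + lam1\<close>, X = \<open>lam\<close>, Y = \<open>mu\<close>
  the result is p at \<mu> and \<lambda>+\<partial>; for Z = \<open>- lam1\<close>, X =
  \<open>lam + mu\<close>, Y = \<open>lam\<close> it is p at \<lambda> and -\<lambda>-\<mu>.\<close>

lemma comp_at_poly_scale:
  assumes F: "semilinear Z s' s F"
  shows "comp_at s F X (poly_scale s' p w) Y =
    poly_scale2 s (coef_at p Y (coef_at Z X pd2)) (comp_at s F X w Y)"
proof -
  interpret F: module_hom s' "twist Z s" F by fact
  have add: "additive F" by (intro additive.intro F.add)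
  show ?thesis
  proof (induction p rule: poly_monom_induct)
    case (monom r i)
    show ?case
    proof (induction w rule: poly_monom_induct)
      case (monom u j)
      show ?case
        by (simp add: F.m1.poly_scale_monom comp_at_monom add F.scale twist_def
            subst_at_poly_scale coef_at_ev1 coef_at_monom power_add mult_ac)
    qed (simp add: F.m1.poly_scale_right_add comp_at_add add pp.scale_right_distrib)
  qed (simp add: F.m1.poly_scale_left_add comp_at_add add pp.scale_left_distrib coef_at.hom_add)
qed

text \<open>Since h is h times 1, the scalar law leaves only the value of F at 1. This treats the
  summand C[\<partial>]x.\<close>

lemma comp_at_ring:
  assumes F: "semilinear Z (*) s F"
  shows "comp_at s F X h Y = poly_scale2 s (coef_at h Y (coef_at Z X pd2)) (subst_at s (F 1) X)"
proof -
  have "h = poly_scale (*) h (monom 1 0)"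
    by (simp add: poly_scale_mult monom_0 flip: one_pCons)
  then have "comp_at s F X h Y = comp_at s F X (poly_scale (*) h (monom 1 0)) Y"
    by simp
  also have "\<dots> = poly_scale2 s (coef_at h Y (coef_at Z X pd2)) (comp_at s F X (monom 1 0) Y)"
    by (rule comp_at_poly_scale[OF F])
  finally show ?thesis
    by (simp only: comp_at_monom module_hom_additive[OF F]) simp
qed

end

text \<open>Constants and \<partial> generate C[\<partial>], so the rules for these two extend to
  every scalar, by induction along r \<mapsto> c + r\<partial>.\<close>

lemma semilinearI:
  assumes s: "cmodule s" and t: "cmodule t" and add: "\<And>u v. F (u + v) = F u + F v"
    and const: "\<And>c u. F (s [:c:] u) = poly_scale t [:[:c:]:] (F u)"
    and pd: "\<And>u. F (s pd u) = poly_scale t Z (F u)"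
  shows "semilinear Z s t F"
proof -
  interpret S: cmodule s by fact
  interpret T: cmodule t by fact
  have "F (s r u) = twist Z t r (F u)" for r u
  proof (induction r arbitrary: u)
    case 0
    show ?case
      using const[of 0] by (simp add: twist_def ev1_const[of _ 0, simplified])
  next
    case (pCons c r)
    have *: "pCons c r = [:c:] + r * pd"
      by (simp add: pd_def)
    show ?case
      using pCons
      by (simp only: * S.scale_left_distrib twist_def ev1.hom_add T.p.scale_left_distrib
          S.scale_scale[symmetric] add pCons ev1.hom_mult ev1_const ev1_pd const pd T.p.scale_scale)
  qed
  then show ?thesis
    by (intro module_hom.intro)
        (auto simp: S.module_axioms T.module_twist module_hom_axioms_def add)
qed

lemma semilinear_iff:
  assumes s: "cmodule s" and t: "cmodule t"
  shows "Vector_Spaces.linear (complex_scale s) (complex_poly_scale t) F \<and>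
     (\<forall>u. F (s pd u) = poly_scale t Z (F u)) \<longleftrightarrow> semilinear Z s t F"
proof
  assume "Vector_Spaces.linear (complex_scale s) (complex_poly_scale t) F \<and>
     (\<forall>u. F (s pd u) = poly_scale t Z (F u))"
  then show "semilinear Z s t F"
    using s t by (intro semilinearI)
        (simp_all add: Vector_Spaces.linear_iff complex_scale_def complex_poly_scale_def)
next
  assume "semilinear Z s t F"
  then interpret module_hom s "twist Z t" F .
  show "Vector_Spaces.linear (complex_scale s) (complex_poly_scale t) F \<and>
     (\<forall>u. F (s pd u) = poly_scale t Z (F u))"
    by (simp add: Vector_Spaces.linear_iff cmodule.vector_space_complex_scale[OF s]
        cmodule.vector_space_complex_poly_scale[OF t] add complex_scale_def complex_poly_scale_def
        scale twist_def ev1_const ev1_pd)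
qed

lemma left_conformal_linear_iff:
  "cmodule s \<Longrightarrow> cmodule t \<Longrightarrow> left_conformal_linear s t F \<longleftrightarrow> semilinear (- lam1) s t F"
  unfolding left_conformal_linear_def by (rule semilinear_iff)

lemma conformal_linear_iff:
  "cmodule s \<Longrightarrow> cmodule t \<Longrightarrow> conformal_linear s t F \<longleftrightarrow> semilinear (pd1 + lam1) s t F"
  unfolding conformal_linear_def by (rule semilinear_iff)

lemma conformal_bilinear_iff:
  "cmodule s \<Longrightarrow> cmodule t \<Longrightarrow> cmodule w \<Longrightarrow> conformal_bilinear s t w f \<longleftrightarrow>
    (\<forall>v. semilinear (- lam1) s w (\<lambda>u. f u v)) \<and> (\<forall>u. semilinear (pd1 + lam1) t w (f u))"
  by (simp add: conformal_bilinear_def left_conformal_linear_iff conformal_linear_iff)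

lemma module_hom_eqI:
  assumes "module_hom s t f" "module_hom s t g" "module.span s B = UNIV" "\<And>b. b \<in> B \<Longrightarrow> f b = g b"
  shows "f u = g u"
proof -
  interpret f: module_hom s t f by fact
  interpret module_pair s t by unfold_locales
  show ?thesis
    by (rule module_hom_eq_on_span[OF assms(1,2,4)]) (auto simp: assms(3))
qed

section \<open>Associativity is determined on generators\<close>

text \<open>\<open>a\<^sub>\<lambda>(b\<^sub>\<mu> c)\<close> and \<open>(a\<^sub>\<lambda> b)\<^bsub>\<lambda>+\<mu>\<^esub> c\<close>.\<close>

definition assoc_l where
  "assoc_l s M a b c = comp_at s (M a) lam (M b c) mu"

definition assoc_r where
  "assoc_r s M a b c = comp_at s (\<lambda>d. M d c) (lam + mu) (M a b) lam"

locale conf_bilinear = cmodule s for s :: "complex poly \<Rightarrow> 'a::ab_group_add \<Rightarrow> 'a" +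
  fixes M :: "'a \<Rightarrow> 'a \<Rightarrow> 'a poly"
  assumes semi_l: "semilinear (- lam1) s s (\<lambda>u. M u v)"
    and semi_r: "semilinear (pd1 + lam1) s s (M u)"
begin

lemma additive_l: "additive (\<lambda>u. M u v)"
  by (rule module_hom_additive[OF semi_l])

lemma additive_r: "additive (M u)"
  by (rule module_hom_additive[OF semi_r])

lemma M_add_l: "M (u + v) = (\<lambda>w. M u w + M v w)"
  by (simp add: fun_eq_iff additive.add[OF additive_l])

lemma scale_l: "M (s r u) v = poly_scale s (ev1 (- lam1) r) (M u v)"
  using module_hom.scale[OF semi_l] by (simp add: twist_def)

lemma M_scale_l: "M (s r u) = (\<lambda>v. poly_scale s (ev1 (- lam1) r) (M u v))"
  by (simp add: fun_eq_iff scale_l)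

lemma scale_r: "M u (s r v) = poly_scale s (ev1 (pd1 + lam1) r) (M u v)"
  using module_hom.scale[OF semi_r] by (simp add: twist_def)

lemmas coef_simps = coef_at_ev1 coef_at_neg_lam1 coef_at_pd1_lam1

lemma assoc_l_1: "module_hom s (twist2 (- lam) s) (\<lambda>a. assoc_l s M a b c)"
  by (auto simp: module_hom_iff module_axioms module_twist2 assoc_l_def M_add_l
      comp_at_fun_add M_scale_l comp_at_fun_poly_scale coef_simps twist2_def)

lemma assoc_l_2: "module_hom s (twist2 (- mu) s) (\<lambda>b. assoc_l s M a b c)"
  by (auto simp: module_hom_iff module_axioms module_twist2 assoc_l_def additive.add[OF additive_l]
      comp_at_add additive_r scale_l comp_at_poly_scale[OF semi_r] coef_simps twist2_def)

text \<open>The scalar leaves the inner product at \<mu> as \<partial>+\<mu>, and the outer product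
  at \<lambda> turns this \<partial> into \<partial>+\<lambda>.\<close>

lemma assoc_l_3: "module_hom s (twist2 (pd2 + lam + mu) s) (\<lambda>c. assoc_l s M a b c)"
  by (auto simp: module_hom_iff module_axioms module_twist2 assoc_l_def additive.add[OF additive_r]
      comp_at_add additive_r scale_r comp_at_poly_scale[OF semi_r] coef_simps twist2_def)

lemma assoc_r_1: "module_hom s (twist2 (- lam) s) (\<lambda>a. assoc_r s M a b c)"
  by (auto simp: module_hom_iff module_axioms module_twist2 assoc_r_def additive.add[OF additive_l]
      comp_at_add additive_l scale_l comp_at_poly_scale[OF semi_l] coef_simps twist2_def)

text \<open>The scalar leaves the inner product as \<partial>+\<lambda>; the outer product at
  \<lambda>+\<mu> turns this \<partial> into -(\<lambda>+\<mu>), and -\<mu> remains.\<close>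

lemma assoc_r_2: "module_hom s (twist2 (- mu) s) (\<lambda>b. assoc_r s M a b c)"
  by (auto simp: module_hom_iff module_axioms module_twist2 assoc_r_def additive.add[OF additive_r]
      comp_at_add additive_l scale_r comp_at_poly_scale[OF semi_l] coef_simps twist2_def)

lemma assoc_r_3: "module_hom s (twist2 (pd2 + lam + mu) s) (\<lambda>c. assoc_r s M a b c)"
  by (auto simp: module_hom_iff module_axioms module_twist2 assoc_r_def additive.add[OF additive_r]
      comp_at_fun_add scale_r[abs_def] comp_at_fun_poly_scale coef_simps twist2_def add.assoc)

lemma assoc_on_generators:
  assumes "span B = UNIV" and "\<And>a b c. a \<in> B \<Longrightarrow> b \<in> B \<Longrightarrow> c \<in> B \<Longrightarrow> assoc_l s M a b c =
      assoc_r s M a b c"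
  shows "assoc_l s M a b c = assoc_r s M a b c"
proof -
  \<comment> \<open>The arguments are released one at a time, from the last to the first; each
    release uses linearity in that argument with the others fixed.\<close>
  have 1: "assoc_l s M a b c = assoc_r s M a b c" if "a \<in> B" "b \<in> B" for a b c
    by (rule module_hom_eqI[OF assoc_l_3 assoc_r_3 assms(1) assms(2)[OF that]])
  have 2: "assoc_l s M a b c = assoc_r s M a b c" if "a \<in> B" for a b c
    by (rule module_hom_eqI[OF assoc_l_2 assoc_r_2 assms(1) 1[OF that]])
  show ?thesis
    by (rule module_hom_eqI[OF assoc_l_1 assoc_r_1 assms(1) 2])
qed

end

text \<open>The associativity law substitutes only \<open>mu\<close> or \<open>lam\<close> into its
  inner products, exactly the cases in which \<open>app_at\<close> and \<open>comp_at\<close>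
  agree.\<close>

lemma assoc_conformal_algebra_iff:
  "assoc_conformal_algebra s M \<longleftrightarrow> conf_bilinear s M \<and> (\<forall>a b c. assoc_l s M a b c =
      assoc_r s M a b c)"
proof -
  have *: "conf_bilinear s M \<longleftrightarrow> module s \<and> conformal_bilinear s s s M"
    by (auto simp: conf_bilinear_def conf_bilinear_axioms_def conformal_bilinear_iff cmodule_def)
  have **: "assoc_l s M a b c = app_at s (M a) lam (subst_at s (M b c) mu)"
    "assoc_r s M a b c = app_at s (\<lambda>d. M d c) (lam + mu) (subst_at s (M a b) lam)"
    if "conf_bilinear s M" for a b c
  proof -
    interpret conf_bilinear s M by fact
    show "assoc_l s M a b c = app_at s (M a) lam (subst_at s (M b c) mu)"
      "assoc_r s M a b c = app_at s (\<lambda>d. M d c) (lam + mu) (subst_at s (M a b) lam)"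
      by (simp_all add: assoc_l_def assoc_r_def app_at_subst_at additive_l additive_r
          cmodule_axioms)
  qed
  show ?thesis
    unfolding assoc_conformal_algebra_def using * ** by metis
qed

section \<open>Bijections between quotients\<close>

text \<open>The common pattern of all four comparisons: the map on classes is the image map of f,
  and properties of s can be pulled back to r.\<close>

locale rel_bij =
  fixes f :: "'a \<Rightarrow> 'b" and A B r s
  assumes bij: "bij_betw f A B" and r: "r \<subseteq> A \<times> A" and s: "s \<subseteq> B \<times> B"
    and rel_iff: "\<And>a a'. a \<in> A \<Longrightarrow> a' \<in> A \<Longrightarrow> (a, a') \<in> r \<longleftrightarrow> (f a, f a') \<in> s"
begin

lemma image_class:
  assumes "a \<in> A"
  shows "f ` (r `` {a}) = s `` {f a}"
proof -
  have "b \<in> f ` (r `` {a})" if "(f a, b) \<in> s" for b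
  proof -
    from that s have "b \<in> B" by auto
    then obtain a' where "a' \<in> A" "b = f a'"
      using bij by (auto simp: bij_betw_def)
    with that rel_iff[OF assms] show ?thesis by auto
  qed
  moreover have "(f a, f a') \<in> s" if "(a, a') \<in> r" for a'
    using that r rel_iff by blast
  ultimately show ?thesis by auto
qed

lemma bij_betw_quotient: "bij_betw ((`) f) (A // r) (B // s)"
proof (rule bij_betw_imageI)
  \<comment> \<open>Classes are subsets of A, and there taking images under the injective f is
    injective.\<close>
  have "A // r \<subseteq> Pow A"
    using r by (auto simp: quotient_def)
  moreover have "inj_on ((`) f) (Pow A)"
    using bij by (simp add: bij_betw_def inj_on_image_Pow)
  ultimately show "inj_on ((`) f) (A // r)"
    by (rule inj_on_subset[rotated])
  have "((`) f) ` (A // r) = (\<lambda>a. s `` {f a}) ` A"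
    by (simp add: quotient_def UNION_singleton_eq_range image_image image_class cong: image_cong)
  also have "\<dots> = (\<lambda>b. s `` {b}) ` (f ` A)"
    by (simp add: image_image)
  also have "\<dots> = B // s"
    using bij by (auto simp: quotient_def bij_betw_def)
  finally show "((`) f) ` (A // r) = B // s" .
qed

lemma equiv_transfer:
  assumes "equiv B s"
  shows "equiv A r"
proof (rule equivI)
  have f: "f a \<in> B" if "a \<in> A" for a
    using that bij by (auto simp: bij_betw_def)
  show "r \<subseteq> A \<times> A" by (rule r)
  show "refl_on A r"
    using assms f r by (auto simp: refl_on_def equiv_def rel_iff)
  show "sym r"
    using assms r rel_iff unfolding sym_def equiv_def by blast
  show "trans r"
    using assms r rel_iff unfolding trans_def equiv_def by (smt (verit) mem_Sigma_iff subsetD)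
qed

end

section \<open>The direct sum\<close>

lemma coeff_pair_poly: "coeff (pair_poly u w) n = (coeff u n, coeff w n)"
  by (simp add: pair_poly_def coeff_map_poly zero_prod_def)

lemma map_poly_fst_pair_poly [simp]: "map_poly fst (pair_poly u w) = u"
  by (intro poly_eqI) (simp add: coeff_map_poly coeff_pair_poly)

lemma map_poly_snd_pair_poly [simp]: "map_poly snd (pair_poly u w) = w"
  by (intro poly_eqI) (simp add: coeff_map_poly coeff_pair_poly)

lemma pair_poly_fst_snd [simp]: "pair_poly (map_poly fst W) (map_poly snd W) = W"
  by (intro poly_eqI) (simp add: coeff_map_poly coeff_pair_poly)

lemma pair_poly_eq_iff [simp]: "pair_poly u w = pair_poly u' w' \<longleftrightarrow> u = u' \<and> w = w'"
  by (metis map_poly_fst_pair_poly map_poly_snd_pair_poly)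

lemma pair_poly_add: "pair_poly u w + pair_poly u' w' = pair_poly (u + u') (w + w')"
  by (intro poly_eqI) (simp add: coeff_pair_poly)

definition sum_map :: "('q \<Rightarrow> 'a::ab_group_add) \<Rightarrow> ('q \<Rightarrow> 'q) \<Rightarrow> 'a \<times> 'q \<Rightarrow> 'a \<times> 'q" where
  "sum_map u v = (\<lambda>(a, y). (a + u y, v y))"

lemma sum_map_Pair [simp]: "sum_map u v (a, y) = (a + u y, v y)"
  by (simp add: sum_map_def)

lemma map_poly_sum_map:
  fixes u :: "'q::ab_group_add \<Rightarrow> 'a::ab_group_add"
  assumes "u 0 = 0" "v 0 = 0"
  shows "map_poly (sum_map u v) (pair_poly p q) = pair_poly (p + map_poly u q) (map_poly v q)"
  by (intro poly_eqI) (simp add: coeff_map_poly coeff_pair_poly sum_map_def assms zero_prod_def)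

text \<open>The map is triangular with the identity on A as a diagonal entry, so only the other
  diagonal entry v decides bijectivity.\<close>

lemma bij_sum_map:
  fixes u :: "'q \<Rightarrow> 'a::ab_group_add"
  shows "bij (sum_map u v) \<longleftrightarrow> bij v"
proof
  assume bij: "bij (sum_map u v)"
  have "inj v"
  proof (rule injI)
    fix y z assume "v y = v z"
    \<comment> \<open>The first coordinates cancel u, so both sides equal (0, v y) and the
      assumption on v applies.\<close>
    then have "sum_map u v (- u y, y) = sum_map u v (- u z, z)"
      by (simp add: sum_map_def)
    from injD[OF bij_is_inj[OF bij] this] show "y = z"
      by simp
  qed
  moreover have "\<exists>y. z = v y" for z
  proof -
    obtain e where "sum_map u v e = (0, z)"
      using bij by (metis bij_pointE)
    then show ?thesis
      by (auto simp: sum_map_def split: prod.splits)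
  qed
  ultimately show "bij v"
    by (auto simp: bij_def surj_def)
next
  assume bij: "bij v"
  show "bij (sum_map u v)"
  proof (rule o_bij)
    show "(\<lambda>(a, z). (a - u (inv v z), inv v z)) \<circ> sum_map u v = id"
      using bij by (auto simp: fun_eq_iff sum_map_def bij_is_inj)
    show "sum_map u v \<circ> (\<lambda>(a, z). (a - u (inv v z), inv v z)) = id"
      using bij by (auto simp: fun_eq_iff sum_map_def bij_is_surj surj_f_inv_f)
  qed
qed

text \<open>The twist acts by polynomial scalars, and \<open>map_poly \<pi>\<close> commutes with
  these; hence restricting arguments and projecting values leaves Z unchanged.\<close>

lemma semilinear_compose:
  assumes F: "semilinear Z s t F" and i: "module_hom s' s i" and p: "module_hom t t' \<pi>"
  shows "semilinear Z s' t' (\<lambda>u. map_poly \<pi> (F (i u)))"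
proof -
  have "module_hom (twist Z t) (twist Z t') (map_poly \<pi>)"
    using module_hom_map_poly[OF p] module_hom.axioms(1,2)[OF p]
    by (simp add: module_hom_iff twist_def cmodule.module_twist[unfolded cmodule_def])
  from module_hom_compose[OF module_hom_compose[OF i F] this] show ?thesis
    by (simp add: o_def)
qed

locale sum_module = A: cmodule sA + Q: cmodule sQ
  for sA :: "complex poly \<Rightarrow> 'a::ab_group_add \<Rightarrow> 'a" and sQ :: "complex poly \<Rightarrow> 'q::ab_group_add \<Rightarrow> 'q"
begin

abbreviation sE :: "complex poly \<Rightarrow> 'a \<times> 'q \<Rightarrow> 'a \<times> 'q" where
  "sE \<equiv> sum_scale sA sQ"

sublocale E: cmodule sE
proof -
  interpret module_prod sA sQ by unfold_locales
  show "cmodule sE" by unfold_locales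
qed

sublocale prod: module_prod sA sQ
  by unfold_locales

lemma module_hom_inl: "module_hom sA sE (\<lambda>a. (a, 0))"
  by unfold_locales (simp_all add: prod.scale_prod)

lemma module_hom_inr: "module_hom sQ sE (\<lambda>y. (0, y))"
  by unfold_locales (simp_all add: prod.scale_prod)

lemma poly_scale_pair: "poly_scale sE p (pair_poly u w) =
    pair_poly (poly_scale sA p u) (poly_scale sQ p w)"
  using map_poly_poly_scale[OF prod.module_hom_fst, of p "pair_poly u w"]
    map_poly_poly_scale[OF prod.module_hom_snd, of p "pair_poly u w"]
  by (metis map_poly_fst_pair_poly map_poly_snd_pair_poly pair_poly_fst_snd)

lemma module_hom_sum_map:
  assumes "module_hom sQ sA u" "module_hom sQ sQ v"
  shows "module_hom sE sE (sum_map u v)"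
proof -
  interpret u: module_hom sQ sA u by fact
  interpret v: module_hom sQ sQ v by fact
  show ?thesis
    by unfold_locales
      (auto simp: sum_map_def prod.scale_prod u.add v.add u.scale v.scale A.scale_right_distrib)
qed

lemma stabilizing_hom:
  assumes "module_hom sE sE \<phi>" "stabilizes \<phi>"
  obtains u v where "module_hom sQ sA u" "module_hom sQ sQ v" "\<phi> = sum_map u v"
proof
  interpret \<phi>: module_hom sE sE \<phi> by fact
  note hom = module_hom_compose[OF module_hom_inr assms(1)]
  from module_hom_compose[OF hom prod.module_hom_fst] show "module_hom sQ sA (\<lambda>y. fst (\<phi> (0, y)))"
    by (simp add: o_def)
  from module_hom_compose[OF hom prod.module_hom_snd] show "module_hom sQ sQ (\<lambda>y. snd (\<phi> (0, y)))"
    by (simp add: o_def)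
  have *: "\<phi> (a, y) = (a, 0) + \<phi> (0, y)" for a y
    using assms(2) \<phi>.add[of "(a, 0)" "(0, y)"] by (simp add: stabilizes_def)
  have **: "\<phi> (a, y) = sum_map (\<lambda>y. fst (\<phi> (0, y))) (\<lambda>y. snd (\<phi> (0, y))) (a, y)" for a y
    unfolding *[of a y] by (simp add: prod_eq_iff)
  show "\<phi> = sum_map (\<lambda>y. fst (\<phi> (0, y))) (\<lambda>y. snd (\<phi> (0, y)))"
    by (intro ext) (metis ** surj_pair)
qed

lemma stabilizes_sum_map: "module_hom sQ sA u \<Longrightarrow> module_hom sQ sQ v \<Longrightarrow> stabilizes (sum_map u v)"
  by (simp add: stabilizes_def sum_map_def module_hom.zero)

lemma ex_stabilizing_iso:
  "(\<exists>\<phi>. conformal_iso sE M M' \<phi> \<and> stabilizes \<phi>) \<longleftrightarrow>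
   (\<exists>u v. module_hom sQ sA u \<and> module_hom sQ sQ v \<and> bij v \<and>
     (\<forall>e e'. map_poly (sum_map u v) (M e e') = M' (sum_map u v e) (sum_map u v e')))"
  (is "?L \<longleftrightarrow> ?R")
proof
  assume ?L
  then obtain \<phi> where \<phi>: "conformal_iso sE M M' \<phi>" "stabilizes \<phi>" by blast
  from \<phi> obtain u v where uv: "module_hom sQ sA u" "module_hom sQ sQ v" "\<phi> = sum_map u v"
    by (metis conformal_iso_def stabilizing_hom)
  moreover from \<phi> uv have "bij v"
    by (simp add: conformal_iso_def bij_sum_map)
  ultimately show ?R
    using \<phi> by (auto simp: conformal_iso_def)
next
  assume ?R
  then show ?L
    unfolding conformal_iso_def using module_hom_sum_map bij_sum_map stabilizes_sum_map by blast
qed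

lemma ex_costabilizing_iso:
  "(\<exists>\<phi>. conformal_iso sE M M' \<phi> \<and> stabilizes \<phi> \<and> costabilizes \<phi>) \<longleftrightarrow>
   (\<exists>u. module_hom sQ sA u \<and>
     (\<forall>e e'. map_poly (sum_map u id) (M e e') = M' (sum_map u id e) (sum_map u id e')))"
  (is "?L \<longleftrightarrow> ?R")
proof
  assume ?L
  then obtain \<phi> where \<phi>: "conformal_iso sE M M' \<phi>" "stabilizes \<phi>" "costabilizes \<phi>" by blast
  from \<phi> obtain u v where uv: "module_hom sQ sA u" "module_hom sQ sQ v" "\<phi> = sum_map u v"
    by (metis conformal_iso_def stabilizing_hom)
  moreover from \<phi>(3) uv(3) have "v = id"
    by (auto simp: costabilizes_def sum_map_def fun_eq_iff)
  ultimately show ?R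
    using \<phi> by (auto simp: conformal_iso_def)
next
  assume ?R
  then obtain u where u: "module_hom sQ sA u"
    and iso: "\<forall>e e'. map_poly (sum_map u id) (M e e') = M' (sum_map u id e) (sum_map u id e')"
    by blast
  have "costabilizes (sum_map u id)"
    by (auto simp: costabilizes_def sum_map_def)
  moreover have "conformal_iso sE M M' (sum_map u id)" "stabilizes (sum_map u id)"
    using u iso module_hom_sum_map[OF u Q.module_hom_id] stabilizes_sum_map[OF u Q.module_hom_id]
    by (auto simp: conformal_iso_def bij_sum_map)
  ultimately show ?L
    by blast
qed

section \<open>Isomorphisms of structures compose and invert, giving equivalence relations\<close>

lemma conformal_iso_id: "conformal_iso sE M M id"
  by (simp add: conformal_iso_def E.module_hom_id)

lemma conformal_iso_inv:
  assumes "conformal_iso sE M M' \<phi>"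
  shows "conformal_iso sE M' M (inv \<phi>)"
proof -
  interpret module_pair sE sE by unfold_locales
  interpret \<phi>: module_hom sE sE \<phi> using assms by (simp add: conformal_iso_def)
  from assms have bij: "bij \<phi>"
    by (simp add: conformal_iso_def)
  have inv0: "inv \<phi> 0 = 0"
    by (metis bij bij_inv_eq_iff \<phi>.zero)
  have "map_poly (inv \<phi>) (M' e e') = M (inv \<phi> e) (inv \<phi> e')" for e e'
  proof -
    have "M' e e' = map_poly \<phi> (M (inv \<phi> e) (inv \<phi> e'))"
      using assms by (simp add: conformal_iso_def bij_is_surj surj_f_inv_f del: split_paired_All)
    then show ?thesis
      by (simp add: map_poly_map_poly inv0 o_def inv_f_f[OF bij_is_inj[OF bij]])
  qed
  with assms show ?thesis
    by (simp add: conformal_iso_def bij_module_hom_imp_inv_module_hom bij_imp_bij_inv)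
qed

lemma conformal_iso_comp:
  assumes "conformal_iso sE M M' \<phi>" "conformal_iso sE M' M'' \<psi>"
  shows "conformal_iso sE M M'' (\<psi> \<circ> \<phi>)"
proof -
  interpret \<phi>: module_hom sE sE \<phi> using assms by (simp add: conformal_iso_def)
  interpret \<psi>: module_hom sE sE \<psi> using assms by (simp add: conformal_iso_def)
  have "map_poly (\<psi> \<circ> \<phi>) w = map_poly \<psi> (map_poly \<phi> w)" for w
    by (simp add: map_poly_map_poly)
  with assms show ?thesis
    by (simp add: conformal_iso_def bij_comp module_hom_compose[of sE sE \<phi> sE \<psi>]
        del: split_paired_All)
qed

lemma stabilizes_inv: "bij \<phi> \<Longrightarrow> stabilizes \<phi> \<Longrightarrow> stabilizes (inv \<phi>)"
  unfolding stabilizes_def by (metis bij_inv_eq_iff)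

lemma costabilizes_inv: "bij \<phi> \<Longrightarrow> costabilizes \<phi> \<Longrightarrow> costabilizes (inv \<phi>)"
  unfolding costabilizes_def fun_eq_iff o_def by (metis bij_inv_eq_iff)

lemma stabilizes_comp: "stabilizes \<phi> \<Longrightarrow> stabilizes \<psi> \<Longrightarrow> stabilizes (\<psi> \<circ> \<phi>)"
  by (simp add: stabilizes_def)

lemma costabilizes_comp: "costabilizes \<phi> \<Longrightarrow> costabilizes \<psi> \<Longrightarrow> costabilizes (\<psi> \<circ> \<phi>)"
  by (metis costabilizes_def o_assoc)

lemma conformal_iso_bij: "conformal_iso s M M' \<phi> \<Longrightarrow> bij \<phi>"
  by (simp add: conformal_iso_def)

lemma equiv_structure_equiv: "equiv (sum_structures sA m sQ) (structure_equiv sA m sQ)"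
proof (rule equivI)
  show "structure_equiv sA m sQ \<subseteq> sum_structures sA m sQ \<times> sum_structures sA m sQ"
    by (auto simp: structure_equiv_def)
  show "refl_on (sum_structures sA m sQ) (structure_equiv sA m sQ)"
    using conformal_iso_id
        by (auto simp: refl_on_def structure_equiv_def stabilizes_def intro!: exI[of _ id])
  show "sym (structure_equiv sA m sQ)"
    using conformal_iso_inv stabilizes_inv conformal_iso_bij
    unfolding structure_equiv_def sym_def by blast
  show "trans (structure_equiv sA m sQ)"
    using conformal_iso_comp stabilizes_comp
    unfolding structure_equiv_def trans_def by blast
qed

lemma equiv_structure_cohom: "equiv (sum_structures sA m sQ) (structure_cohom sA m sQ)"
proof (rule equivI)
  show "structure_cohom sA m sQ \<subseteq> sum_structures sA m sQ \<times> sum_structures sA m sQ"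
    by (auto simp: structure_cohom_def)
  show "refl_on (sum_structures sA m sQ) (structure_cohom sA m sQ)"
    using conformal_iso_id
    by (auto simp: refl_on_def structure_cohom_def stabilizes_def costabilizes_def intro!:
        exI[of _ id])
  show "sym (structure_cohom sA m sQ)"
    using conformal_iso_inv stabilizes_inv costabilizes_inv conformal_iso_bij
    unfolding structure_cohom_def sym_def by blast
  show "trans (structure_cohom sA m sQ)"
    using conformal_iso_comp stabilizes_comp costabilizes_comp
    unfolding structure_cohom_def trans_def by blast
qed

end

section \<open>Extending structures and structures on the direct sum\<close>

text \<open>The inverse of \<open>ext_product m\<close>: each operation is the A- or Q-component of
  a product of elements taken from the summands.\<close>

definition ext_of :: "('a \<times> 'q \<Rightarrow> 'a \<times> 'q \<Rightarrow> ('a \<times> 'q) poly) \<Rightarrow> ('a::ab_group_add, 'q::ab_group_add)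
    ext_datum" where
  "ext_of M =
    (\<lambda>a z. map_poly fst (M (a, 0) (0, z)), \<lambda>a z. map_poly snd (M (a, 0) (0, z)),
     \<lambda>y b. map_poly snd (M (0, y) (b, 0)), \<lambda>y b. map_poly fst (M (0, y) (b, 0)),
     \<lambda>y z. map_poly fst (M (0, y) (0, z)), \<lambda>y z. map_poly snd (M (0, y) (0, z)))"

lemma conformal_bilinear_compose:
  assumes M: "conf_bilinear s M" and i: "module_hom t s i" and j: "module_hom t' s j"
    and p: "module_hom s w \<pi>"
  shows "conformal_bilinear t t' w (\<lambda>u v. map_poly \<pi> (M (i u) (j v)))"
proof -
  interpret conf_bilinear s M by fact
  have "cmodule t" "cmodule t'" "cmodule w"
    using i j p by (simp_all add: module_hom_def cmodule_def)
  then show ?thesis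
    using semilinear_compose[OF semi_l i p] semilinear_compose[OF semi_r j p]
    by (simp add: conformal_bilinear_iff)
qed

text \<open>Moves the inverse of v to the other side of an equation. Preservation of 0 is what makes
  \<open>map_poly\<close> respect composition.\<close>

lemma map_poly_inv_eq_iff:
  fixes v :: "'q::ab_group_add \<Rightarrow> 'q"
  assumes "bij v" "v 0 = 0"
  shows "p = map_poly (inv v) q \<longleftrightarrow> map_poly v p = q"
proof -
  have "inv v 0 = 0"
    by (metis assms bij_inv_eq_iff)
  then have "map_poly v (map_poly (inv v) q) = q" "map_poly (inv v) (map_poly v p) = p"
    using assms
    by (simp_all add: map_poly_map_poly o_def inv_f_f[OF bij_is_inj] surj_f_inv_f[OF bij_is_surj])
  then show ?thesis
    by metis
qed

locale conf_extension = sum_module sA sQ + A: conf_bilinear sA m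
  for sA :: "complex poly \<Rightarrow> 'a::ab_group_add \<Rightarrow> 'a" and m
    and sQ :: "complex poly \<Rightarrow> 'q::ab_group_add \<Rightarrow> 'q"
begin

lemma TC_D:
  assumes "(lh, rh, lt, rt, f, c) \<in> TC sA m sQ"
  shows "additive (lh a)" "additive (\<lambda>a. lh a y)" "additive (rh a)" "additive (\<lambda>a. rh a y)"
    "additive (lt y)" "additive (\<lambda>y. lt y a)" "additive (rt y)" "additive (\<lambda>y. rt y a)"
    "additive (f y)" "additive (\<lambda>y. f y z)" "additive (c y)" "additive (\<lambda>y. c y z)"
  using assms
  by (auto simp: TC_def conformal_bilinear_iff A.cmodule_axioms Q.cmodule_axioms
      intro: module_hom_additive)

lemma sum_structures_conf_bilinear: "M \<in> sum_structures sA m sQ \<Longrightarrow> conf_bilinear sE M"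
  by (simp add: sum_structures_def assoc_conformal_algebra_iff)

lemma ext_product_in_sum_structures:
  assumes "\<Omega> \<in> TC sA m sQ"
  shows "ext_product m \<Omega> \<in> sum_structures sA m sQ"
proof -
  obtain lh rh lt rt f c where \<Omega>: "\<Omega> = (lh, rh, lt, rt, f, c)"
    by (metis prod.collapse)
  note add = TC_D[OF assms[unfolded \<Omega>]]
  show ?thesis
    using assms unfolding \<Omega>
    by (simp add: sum_structures_def TC_def ext_product_def add[THEN additive.zero])
qed

lemma ext_of_ext_product:
  assumes "\<Omega> \<in> TC sA m sQ"
  shows "ext_of (ext_product m \<Omega>) = \<Omega>"
proof -
  obtain lh rh lt rt f c where \<Omega>: "\<Omega> = (lh, rh, lt, rt, f, c)"
    by (metis prod.collapse)
  note add = TC_D[OF assms[unfolded \<Omega>]]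
  show ?thesis
    by (simp add: \<Omega> ext_of_def ext_product_def add[THEN additive.zero]
        A.additive_l[THEN additive.zero] A.additive_r[THEN additive.zero])
qed

text \<open>Bilinearity splits a product into four products of summands. Three are recorded by
  \<open>ext_of M\<close>, and the fourth is fixed because A is a subalgebra.\<close>

lemma ext_product_ext_of:
  assumes "M \<in> sum_structures sA m sQ"
  shows "ext_product m (ext_of M) = M"
proof -
  interpret M: conf_bilinear sE M
    using assms by (rule sum_structures_conf_bilinear)
  have M_A: "M (a, 0) (b, 0) = pair_poly (m a b) 0" for a b
    using assms by (simp add: sum_structures_def)
  have "ext_product m (ext_of M) (a, y) (b, z) = M (a, y) (b, z)" for a y b z
  proof -
    obtain p q where pq: "M (a, 0) (0, z) = pair_poly p q"
      by (metis pair_poly_fst_snd)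
    obtain p' q' where pq': "M (0, y) (b, 0) = pair_poly p' q'"
      by (metis pair_poly_fst_snd)
    obtain p'' q'' where pq'': "M (0, y) (0, z) = pair_poly p'' q''"
      by (metis pair_poly_fst_snd)
    have "M (a, y) (b, z) = M ((a, 0) + (0, y)) ((b, 0) + (0, z))"
      by simp
    also have "\<dots> = M (a, 0) (b, 0) + M (a, 0) (0, z) + (M (0, y) (b, 0) + M (0, y) (0, z))"
      by (simp only: additive.add[OF M.additive_l] additive.add[OF M.additive_r] add_ac)
    finally show ?thesis
      by (simp add: ext_product_def ext_of_def M_A pq pq' pq'' pair_poly_add add_ac)
  qed
  then show ?thesis
    by (simp add: fun_eq_iff)
qed

lemma ext_of_in_TC:
  assumes "M \<in> sum_structures sA m sQ"
  shows "ext_of M \<in> TC sA m sQ"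
proof -
  note bil = conformal_bilinear_compose[OF sum_structures_conf_bilinear[OF assms]]
  have "assoc_conformal_algebra sE (ext_product m (ext_of M))"
    unfolding ext_product_ext_of[OF assms] using assms by (simp add: sum_structures_def)
  then show ?thesis
    using bil[OF module_hom_inl module_hom_inr prod.module_hom_fst]
      bil[OF module_hom_inl module_hom_inr prod.module_hom_snd]
      bil[OF module_hom_inr module_hom_inl prod.module_hom_fst]
      bil[OF module_hom_inr module_hom_inl prod.module_hom_snd]
      bil[OF module_hom_inr module_hom_inr prod.module_hom_fst]
      bil[OF module_hom_inr module_hom_inr prod.module_hom_snd]
    by (simp add: TC_def ext_of_def)
qed

lemma bij_betw_ext_product: "bij_betw (ext_product m) (TC sA m sQ) (sum_structures sA m sQ)"
  by (rule bij_betw_byWitness[of _ ext_of])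
    (auto simp: ext_of_ext_product ext_product_ext_of ext_product_in_sum_structures ext_of_in_TC)

text \<open>The homomorphism condition has an A- and a Q-component. Restricted to A \<times> Q, Q
  \<times> A and Q \<times> Q they are the six defining equations, once the inverse of v and the
  subtracted u-terms are moved across; on A \<times> A they hold trivially.\<close>

lemma ext_related_iff:
  assumes \<Omega>: "\<Omega> \<in> TC sA m sQ" "\<Omega>' \<in> TC sA m sQ"
    and u: "module_hom sQ sA u" and v: "module_hom sQ sQ v" "bij v"
  shows "ext_related m u v \<Omega> \<Omega>' \<longleftrightarrow>
    (\<forall>e e'. map_poly (sum_map u v) (ext_product m \<Omega> e e') =
       ext_product m \<Omega>' (sum_map u v e) (sum_map u v e'))"
proof -
  obtain lh rh lt rt f c where 1: "\<Omega> = (lh, rh, lt, rt, f, c)"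
    by (metis prod.collapse)
  obtain lh' rh' lt' rt' f' c' where 2: "\<Omega>' = (lh', rh', lt', rt', f', c')"
    by (metis prod.collapse)
  note add = TC_D[OF \<Omega>(1)[unfolded 1]] TC_D[OF \<Omega>(2)[unfolded 2]] A.additive_l A.additive_r
    module_hom_additive[OF u] module_hom_additive[OF v(1)]
    additive_map_poly[OF module_hom_additive[OF u]]
        additive_map_poly[OF module_hom_additive[OF v(1)]]
  note zero = add[THEN additive.zero]
  note inv = map_poly_inv_eq_iff[OF v(2) module_hom.zero[OF v(1)]]
  let ?P = "\<lambda>a y b z.
    m a b + lh a z + rt y b + f y z + map_poly u (rh a z + lt y b + c y z)
      = m (a + u y) (b + u z) + lh' (a + u y) (v z) + rt' (v y) (b + u z) + f' (v y) (v z) \<and>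
    map_poly v (rh a z + lt y b + c y z) = rh' (a + u y) (v z) + lt' (v y) (b + u z) +
        c' (v y) (v z)"
  have "(\<forall>e e'. map_poly (sum_map u v) (ext_product m \<Omega> e e') =
       ext_product m \<Omega>' (sum_map u v e) (sum_map u v e')) \<longleftrightarrow> (\<forall>a y b z. ?P a y b z)"
    by (simp add: 1 2 ext_product_def map_poly_sum_map zero)
  moreover have "ext_related m u v \<Omega> \<Omega>'" if P: "\<And>a y b z. ?P a y b z"
  proof -
    have "map_poly v (rh a y) = rh' a (v y) \<and> lh a y + map_poly u (rh a y) = m a (u y) +
        lh' a (v y)" for a y
      using P[where a=a and y=0 and b=0 and z=y] by (simp add: zero)
    then have "rh a y = map_poly (inv v) (rh' a (v y)) \<and>
       lh a y = m a (u y) + lh' a (v y) - map_poly u (rh a y)" for a y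
      unfolding inv eq_diff_eq by blast
    moreover have "map_poly v (lt y a) = lt' (v y) a \<and> rt y a + map_poly u (lt y a) = m (u y) a +
        rt' (v y) a" for y a
      using P[where a=0 and y=y and b=a and z=0] by (simp add: zero)
    then have "lt y a = map_poly (inv v) (lt' (v y) a) \<and>
       rt y a = m (u y) a + rt' (v y) a - map_poly u (lt y a)" for y a
      unfolding inv eq_diff_eq by blast
    moreover have "map_poly v (c y z) = rh' (u y) (v z) + lt' (v y) (u z) + c' (v y) (v z) \<and>
       f y z + map_poly u (c y z) = m (u y) (u z) + lh' (u y) (v z) + rt' (v y) (u z) +
           f' (v y) (v z)" for y z
      using P[where a=0 and y=y and b=0 and z=z] by (simp add: zero)
    then have "c y z = map_poly (inv v) (rh' (u y) (v z) + lt' (v y) (u z) + c' (v y) (v z)) \<and>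
       f y z = m (u y) (u z) + lh' (u y) (v z) + rt' (v y) (u z) + f' (v y) (v z)
                 - map_poly u (c y z)" for y z
      unfolding inv eq_diff_eq by blast
    ultimately show ?thesis
      by (simp add: 1 2 ext_related_def)
  qed
  moreover have "?P a y b z" if "ext_related m u v \<Omega> \<Omega>'" for a y b z
  proof -
    from that have *: "map_poly v (rh a z) = rh' a (v z)"
      "lh a z + map_poly u (rh a z) = m a (u z) + lh' a (v z)"
      "map_poly v (lt y b) = lt' (v y) b"
      "rt y b + map_poly u (lt y b) = m (u y) b + rt' (v y) b"
      "map_poly v (c y z) = rh' (u y) (v z) + lt' (v y) (u z) + c' (v y) (v z)"
      "f y z + map_poly u (c y z) = m (u y) (u z) + lh' (u y) (v z) + rt' (v y) (u z) +
          f' (v y) (v z)"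
      by (auto simp: 1 2 ext_related_def inv eq_diff_eq)
    \<comment> \<open>The sum of the three A-equations; together with \<open>m a b\<close> on both
      sides and additivity it is the A-component of the full condition.\<close>
    have "(lh a z + map_poly u (rh a z)) + (rt y b + map_poly u (lt y b)) +
        (f y z + map_poly u (c y z)) =
        (m a (u z) + lh' a (v z)) + (m (u y) b + rt' (v y) b) +
        (m (u y) (u z) + lh' (u y) (v z) + rt' (v y) (u z) + f' (v y) (v z))"
      by (simp only: *)
    then show ?thesis
      by (simp add: *(1,3,5) add[THEN additive.add] add_ac)
  qed
  ultimately show ?thesis
    by blast
qed

lemma ext_equiv_rel_bij:
  "rel_bij (ext_product m) (TC sA m sQ) (sum_structures sA m sQ) (ext_equiv sA m sQ)
      (structure_equiv sA m sQ)"
proof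
  show "bij_betw (ext_product m) (TC sA m sQ) (sum_structures sA m sQ)"
    by (rule bij_betw_ext_product)
  show "ext_equiv sA m sQ \<subseteq> TC sA m sQ \<times> TC sA m sQ"
    by (auto simp: ext_equiv_def)
  show "structure_equiv sA m sQ \<subseteq> sum_structures sA m sQ \<times> sum_structures sA m sQ"
    by (auto simp: structure_equiv_def)
  fix \<Omega> \<Omega>' assume \<Omega>: "\<Omega> \<in> TC sA m sQ" "\<Omega>' \<in> TC sA m sQ"
  show "(\<Omega>, \<Omega>') \<in> ext_equiv sA m sQ \<longleftrightarrow>
      (ext_product m \<Omega>, ext_product m \<Omega>') \<in> structure_equiv sA m sQ"
    unfolding structure_equiv_def ext_equiv_def mem_Collect_eq case_prod_conv ex_stabilizing_iso
    by (intro conj_cong ex_cong1 refl ext_related_iff \<Omega>)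
      (simp_all add: \<Omega> ext_product_in_sum_structures)
qed

lemma ext_cohom_rel_bij:
  "rel_bij (ext_product m) (TC sA m sQ) (sum_structures sA m sQ) (ext_cohom sA m sQ)
      (structure_cohom sA m sQ)"
proof
  show "bij_betw (ext_product m) (TC sA m sQ) (sum_structures sA m sQ)"
    by (rule bij_betw_ext_product)
  show "ext_cohom sA m sQ \<subseteq> TC sA m sQ \<times> TC sA m sQ"
    by (auto simp: ext_cohom_def)
  show "structure_cohom sA m sQ \<subseteq> sum_structures sA m sQ \<times> sum_structures sA m sQ"
    by (auto simp: structure_cohom_def)
  fix \<Omega> \<Omega>' assume \<Omega>: "\<Omega> \<in> TC sA m sQ" "\<Omega>' \<in> TC sA m sQ"
  show "(\<Omega>, \<Omega>') \<in> ext_cohom sA m sQ \<longleftrightarrow>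
      (ext_product m \<Omega>, ext_product m \<Omega>') \<in> structure_cohom sA m sQ"
    unfolding structure_cohom_def ext_cohom_def mem_Collect_eq case_prod_conv ex_costabilizing_iso
    by (intro conj_cong ex_cong1 refl ext_related_iff \<Omega>)
      (simp_all add: \<Omega> ext_product_in_sum_structures Q.module_hom_id)
qed

end

section \<open>Naturality of substitution and composition\<close>

abbreviation map_poly2 :: "('a::zero \<Rightarrow> 'b::zero) \<Rightarrow> 'a poly poly \<Rightarrow> 'b poly poly" where
  "map_poly2 f \<equiv> map_poly (map_poly f)"

lemma module_hom_map_poly2:
  "module_hom s t f \<Longrightarrow> module_hom (poly_scale2 s) (poly_scale2 t) (map_poly2 f)"
  by (intro module_hom_map_poly)

text \<open>Needed to compute in A \<oplus> Q componentwise: applied to the inclusions of A and of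
  C[\<partial>]x, it reduces substitution in the sum to substitution in each summand.\<close>

lemma map_poly2_subst_at:
  assumes f: "module_hom s t f"
  shows "map_poly2 f (subst_at s w X) = subst_at t (map_poly f w) X"
proof -
  interpret f: module_hom s t f by fact
  interpret S: cmodule s by unfold_locales
  interpret T: cmodule t by unfold_locales
  interpret ff: module_hom "poly_scale2 s" "poly_scale2 t" "map_poly2 f"
    by (rule module_hom_map_poly2[OF f])
  show ?thesis
    by (induction w rule: poly_monom_induct)
      (simp_all add: S.subst_at_add T.subst_at_add map_poly_add module_hom_additive[OF f] ff.add
        map_poly_monom S.subst_at_monom T.subst_at_monom ff.scale map_poly_pCons)
qed

lemma map_poly2_comp_at:
  assumes f: "module_hom s t f" and F: "additive F"
  shows "map_poly2 f (comp_at s F X w Y) = comp_at t (\<lambda>u. map_poly f (F u)) X w Y"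
proof -
  interpret f: module_hom s t f by fact
  interpret S: cmodule s by unfold_locales
  interpret T: cmodule t by unfold_locales
  interpret ff: module_hom "poly_scale2 s" "poly_scale2 t" "map_poly2 f"
    by (rule module_hom_map_poly2[OF f])
  show ?thesis
    by (simp add: comp_at_def ff.sum ff.scale map_poly2_subst_at[OF f])
qed

lemma (in cmodule) comp_at_map_poly:
  assumes F: "additive F" and i: "additive i"
  shows "comp_at s F X (map_poly i w) Y = comp_at s (\<lambda>u. F (i u)) X w Y"
proof -
  have Fi: "additive (\<lambda>u. F (i u))"
    by (intro additive.intro) (simp add: additive.add[OF F] additive.add[OF i])
  show ?thesis
    by (induction w rule: poly_monom_induct)
      (simp_all add: map_poly_add i comp_at_add F Fi map_poly_monom additive.zero[OF i]
          comp_at_monom)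
qed

lemma cmodule_mult: "cmodule ((*) :: complex poly \<Rightarrow> complex poly \<Rightarrow> complex poly)"
  by (simp add: cmodule_def module_mult)

interpretation R: cmodule "(*) :: complex poly \<Rightarrow> complex poly \<Rightarrow> complex poly"
  by (rule cmodule_mult)

lemma subst_at_mult: "subst_at (*) p X = coef_at p X pd2"
  by (induction p rule: poly_monom_induct)
    (simp_all add: R.subst_at_add coef_at.hom_add R.subst_at_monom coef_at_monom ev2_pd2
        poly_scale_mult)

lemma conf_bilinear_eqI:
  assumes M: "conf_bilinear s M" and M': "conf_bilinear s M'" and B: "module.span s B = UNIV"
    and eq: "\<And>a b. a \<in> B \<Longrightarrow> b \<in> B \<Longrightarrow> M a b = M' a b"
  shows "M = M'"
proof (intro ext)
  fix a b
  interpret M: conf_bilinear s M by fact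
  interpret M': conf_bilinear s M' by fact
  have "M a b = M' a b" if "a \<in> B" for a b
    by (rule module_hom_eqI[OF M.semi_r M'.semi_r B eq[OF that]])
  then show "M a b = M' a b"
    by (rule module_hom_eqI[OF M.semi_l M'.semi_l B])
qed

section \<open>Flag products\<close>

locale rank1_sum = sum_module sA sQ
  for sA :: "complex poly \<Rightarrow> 'a::ab_group_add \<Rightarrow> 'a"
      and sQ :: "complex poly \<Rightarrow> 'q::ab_group_add \<Rightarrow> 'q" +
  fixes x :: 'q
  assumes x_indep: "Q.independent {x}" and x_span: "Q.span {x} = UNIV"
begin

lemma scale_x_eq_0_iff [simp]: "sQ r x = 0 \<longleftrightarrow> r = 0"
  using Q.independentD[OF x_indep, of "{x}" "\<lambda>_. r" x] by auto

lemma scale_x_inj [simp]: "sQ r x = sQ r' x \<longleftrightarrow> r = r'"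
  using scale_x_eq_0_iff[of "r - r'"] by (simp add: Q.scale_left_diff_distrib)

lemma bij_scale_x: "bij (\<lambda>r. sQ r x)"
proof -
  have "range (\<lambda>r. sQ r x) = UNIV"
    using x_span by (simp add: Q.span_singleton)
  then show ?thesis
    by (auto simp: bij_def inj_def)
qed

definition coord :: "'q \<Rightarrow> complex poly" where
  "coord = inv (\<lambda>r. sQ r x)"

lemma coord_scale [simp]: "coord (sQ r x) = r"
  unfolding coord_def by (rule inv_f_f[OF bij_is_inj[OF bij_scale_x]])

lemma scale_coord [simp]: "sQ (coord y) x = y"
  unfolding coord_def by (rule surj_f_inv_f[OF bij_is_surj[OF bij_scale_x]])

lemma coord_x [simp]: "coord x = 1"
  using coord_scale[of 1] by simp

lemma module_hom_scale_x: "module_hom (*) sQ (\<lambda>r. sQ r x)"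
  by unfold_locales (simp_all add: Q.scale_left_distrib)

lemma module_hom_coord: "module_hom sQ (*) coord"
proof -
  interpret module_pair "(*) :: complex poly \<Rightarrow> _" sQ by unfold_locales
  show ?thesis
    unfolding coord_def
        by (rule bij_module_hom_imp_inv_module_hom[OF module_hom_scale_x bij_scale_x])
qed

lemmas coord_add [simp] = module_hom.add[OF module_hom_coord]
lemmas coord_sQ [simp] = module_hom.scale[OF module_hom_coord]

lemma coord_0 [simp]: "coord 0 = 0"
  by (rule module_hom.zero[OF module_hom_coord])

lemma hom_Q_eq:
  assumes "module_hom sQ s u"
  shows "u y = s (coord y) (u x)"
  using module_hom.scale[OF assms, of "coord y" x] by simp

definition pair_x :: "'a poly \<Rightarrow> complex poly poly \<Rightarrow> ('a \<times> 'q) poly" where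
  "pair_x u p = pair_poly u (map_poly (\<lambda>r. sQ r x) p)"

lemma map_poly_coord [simp]: "map_poly coord (map_poly (\<lambda>r. sQ r x) p) = p"
  by (simp add: map_poly_map_poly o_def)

lemma map_poly_scale_x [simp]: "map_poly (\<lambda>r. sQ r x) (map_poly coord p) = p"
  by (simp add: map_poly_map_poly o_def)

lemma pair_x_eq_iff [simp]: "pair_x u p = pair_x u' p' \<longleftrightarrow> u = u' \<and> p = p'"
  unfolding pair_x_def pair_poly_eq_iff by (metis map_poly_coord)

lemma pair_x_cases:
  obtains u p where "W = pair_x u p"
  by (metis pair_x_def map_poly_scale_x pair_poly_fst_snd)

lemma pair_x_add: "pair_x u p + pair_x u' p' = pair_x (u + u') (p + p')"
  by (simp add: pair_x_def pair_poly_add map_poly_add module_hom_additive[OF module_hom_scale_x])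

lemma poly_scale_pair_x: "poly_scale sE q (pair_x u p) = pair_x (poly_scale sA q u) (q * p)"
  using map_poly_poly_scale[OF module_hom_scale_x, of q p]
  by (simp add: pair_x_def poly_scale_pair poly_scale_mult)

lemma module_hom_inx: "module_hom (*) sE (\<lambda>r. (0, sQ r x))"
  using module_hom_compose[OF module_hom_scale_x module_hom_inr] by (simp add: o_def)

text \<open>Elements of (A \<oplus> Q)[\<lambda>,\<mu>] in coordinates. Writing them as a sum of
  images of two homomorphisms lets the naturality lemmas act on each summand.\<close>

definition pair_x2 :: "'a poly poly \<Rightarrow> complex poly poly poly \<Rightarrow> ('a \<times> 'q) poly poly" where
  "pair_x2 W p = map_poly2 (\<lambda>a. (a, 0)) W + map_poly2 (\<lambda>r. (0, sQ r x)) p"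

lemma pair_x2_eq_iff [simp]: "pair_x2 W p = pair_x2 W' p' \<longleftrightarrow> W = W' \<and> p = p'"
proof -
  have c: "coeff (coeff (pair_x2 W p) i) j = (coeff (coeff W i) j, sQ (coeff (coeff p i) j) x)"
      for W p i j
    by (simp add: pair_x2_def coeff_map_poly zero_prod_def)
  have "W = W' \<and> p = p'" if "pair_x2 W p = pair_x2 W' p'"
    using c[of W p] c[of W' p'] unfolding that by (auto simp: poly_eq_iff)
  then show ?thesis
    by blast
qed

lemma pair_x2_add: "pair_x2 W p + pair_x2 W' p' = pair_x2 (W + W') (p + p')"
  by (simp add: pair_x2_def module_hom.add[OF module_hom_map_poly2[OF module_hom_inl]]
      module_hom.add[OF module_hom_map_poly2[OF module_hom_inx]])

lemma poly_scale2_pair_x2: "poly_scale2 sE q (pair_x2 W p) = pair_x2 (poly_scale2 sA q W) (q * p)"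
  using module_hom.scale[OF module_hom_map_poly2[OF module_hom_inl], of q W]
    module_hom.scale[OF module_hom_map_poly2[OF module_hom_inx], of q p]
  by (simp add: pair_x2_def E.pp.scale_right_distrib poly_scale_mult)

lemma pair_x_split: "pair_x u p = map_poly (\<lambda>a. (a, 0)) u + map_poly (\<lambda>r. (0, sQ r x)) p"
  by (intro poly_eqI) (simp add: pair_x_def coeff_pair_poly coeff_map_poly zero_prod_def)

lemma subst_at_pair_x: "subst_at sE (pair_x u p) X = pair_x2 (subst_at sA u X) (coef_at p X pd2)"
  by (simp add: pair_x_split E.subst_at_add pair_x2_def map_poly2_subst_at[OF module_hom_inl]
      map_poly2_subst_at[OF module_hom_inx, unfolded subst_at_mult])

text \<open>The single computation behind all associators: H will be left or right multiplication by
  a fixed generator. On the A-part of the argument H acts through F and f; on the part p x only its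
  value at x matters, multiplied by the transported scalar p.\<close>

lemma comp_at_pair_x:
  assumes H: "semilinear Z sE sE H" and F: "additive F" "additive f"
    and HF: "\<And>a. H (a, 0) = pair_x (F a) (f a)" and Hx: "H (0, x) = pair_x v q"
  shows "comp_at sE H X (pair_x u p) Y = pair_x2
    (comp_at sA F X u Y + poly_scale2 sA (coef_at p Y (coef_at Z X pd2)) (subst_at sA v X))
    (comp_at (*) f X u Y + coef_at p Y (coef_at Z X pd2) * coef_at q X pd2)"
proof -
  have H_add: "additive H"
    by (rule module_hom_additive[OF H])
  have "comp_at sE H X (map_poly (\<lambda>a. (a, 0)) u) Y = comp_at sE (\<lambda>a. pair_x (F a) (f a)) X u Y"
    by (simp add: E.comp_at_map_poly H_add module_hom_additive[OF module_hom_inl] HF)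
  also have "\<dots> = pair_x2 (comp_at sA F X u Y) (comp_at (*) f X u Y)"
    by (simp add: pair_x_split E.comp_at_fun_add pair_x2_def map_poly2_comp_at[OF module_hom_inl
        F(1)]
      map_poly2_comp_at[OF module_hom_inx F(2)])
  finally have 1: "comp_at sE H X (map_poly (\<lambda>a. (a, 0)) u) Y =
      pair_x2 (comp_at sA F X u Y) (comp_at (*) f X u Y)" .
  \<comment> \<open>Precomposing with r \<mapsto> (0, r x) gives a semilinear map on the ring
    C[\<partial>], determined by its value at 1, that is, at x.\<close>
  have "semilinear Z (*) sE (\<lambda>r. H (0, sQ r x))"
    using module_hom_compose[OF module_hom_inx H] by (simp add: o_def)
  from E.comp_at_ring[OF this] have "comp_at sE H X (map_poly (\<lambda>r. (0, sQ r x)) p) Y =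
      poly_scale2 sE (coef_at p Y (coef_at Z X pd2)) (subst_at sE (H (0, x)) X)"
    by (simp add: E.comp_at_map_poly H_add module_hom_additive[OF module_hom_inx])
  also have "\<dots> = pair_x2 (poly_scale2 sA (coef_at p Y (coef_at Z X pd2)) (subst_at sA v X))
      (coef_at p Y (coef_at Z X pd2) * coef_at q X pd2)"
    by (simp add: Hx subst_at_pair_x poly_scale2_pair_x2)
  finally show ?thesis
    using 1 by (simp add: pair_x_split E.comp_at_add H_add pair_x2_add)
qed

lemma span_inl:
  assumes "A.span V = UNIV"
  shows "E.span ((\<lambda>a. (a, 0)) ` V \<union> {(0, x)}) = UNIV"
proof -
  let ?S = "(\<lambda>a. (a, 0)) ` V \<union> {(0, x)}"
  have 1: "(a, 0) \<in> E.span ?S" for a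
  proof -
    have "(a, 0) \<in> E.span ((\<lambda>a. (a, 0)) ` V)"
      unfolding module_hom.span_image[OF module_hom_inl] assms by simp
    then show ?thesis
      using E.span_mono[of "(\<lambda>a. (a, 0)) ` V" ?S] by blast
  qed
  have 2: "(0, y) \<in> E.span ?S" for y
    using E.span_scale[OF E.span_base[of "(0, x)" ?S], of "coord y"] by (simp add: prod.scale_prod)
  have "(a, y) \<in> E.span ?S" for a y
    using E.span_add[OF 1 2, of a y] by simp
  then show ?thesis
    by auto
qed

text \<open>The product of \<open>AC\<close> expanded bilinearly. The scalars r and t are the
  coordinates of y and z after leaving the left and the right argument, respectively.\<close>

definition flag_product :: "('a \<Rightarrow> 'a \<Rightarrow> 'a poly) \<Rightarrow> 'a flag \<Rightarrow> 'a \<times> 'q \<Rightarrow> 'a \<times> 'q \<Rightarrow> ('a \<times> 'q) poly"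
    where
  "flag_product m = (\<lambda>(h, D, g, T, Q0, P) (a, y) (b, z).
     let r = ev1 (- lam1) (coord y); t = ev1 (pd1 + lam1) (coord z) in
     pair_x (m a b + poly_scale sA t (D a) + poly_scale sA r (T b) + poly_scale sA (r * t) Q0)
            (t * h a + r * g b + r * t * P))"

end

text \<open>The linearity part of a flag datum, separated from the fourteen equations: it already
  makes \<open>flag_product\<close> conformal bilinear, so the equations can be matched with
  associativity alone.\<close>

definition flag_maps :: "(complex poly \<Rightarrow> 'a::ab_group_add \<Rightarrow> 'a) \<Rightarrow> 'a flag \<Rightarrow> bool" where
  "flag_maps s = (\<lambda>(h, D, g, T, Q0, P).
     semilinear (- lam1) s (*) h \<and> semilinear (- lam1) s s D \<and>
     semilinear (pd1 + lam1) s (*) g \<and> semilinear (pd1 + lam1) s s T)"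

locale rank1_extension = rank1_sum sA sQ x + conf_extension sA m sQ
  for sA :: "complex poly \<Rightarrow> 'a::ab_group_add \<Rightarrow> 'a" and m
    and sQ :: "complex poly \<Rightarrow> 'q::ab_group_add \<Rightarrow> 'q" and x +
  fixes V :: "'a set"
  assumes V_span: "A.span V = UNIV"
    and assoc: "\<And>a b c. assoc_l sA m a b c = assoc_r sA m a b c"

locale flag_datum = rank1_extension sA m sQ x V
  for sA :: "complex poly \<Rightarrow> 'a::ab_group_add \<Rightarrow> 'a" and m
    and sQ :: "complex poly \<Rightarrow> 'q::ab_group_add \<Rightarrow> 'q" and x V +
  fixes h D g T Q0 P
  assumes flag_maps: "flag_maps sA (h, D, g, T, Q0, P)"
begin

abbreviation M :: "'a \<times> 'q \<Rightarrow> 'a \<times> 'q \<Rightarrow> ('a \<times> 'q) poly" where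
  "M \<equiv> flag_product m (h, D, g, T, Q0, P)"

lemma semilinear_flag:
  "semilinear (- lam1) sA (*) h" "semilinear (- lam1) sA sA D"
  "semilinear (pd1 + lam1) sA (*) g" "semilinear (pd1 + lam1) sA sA T"
  using flag_maps by (simp_all add: flag_maps_def)

lemmas flag_additive = semilinear_flag[THEN module_hom_additive]
lemmas flag_zero = flag_additive[THEN additive.zero] ev1.additive[THEN additive.zero]
  A.additive_l[THEN additive.zero] A.additive_r[THEN additive.zero]

lemma flag_scale:
  "h (sA r a) = ev1 (- lam1) r * h a" "D (sA r a) = poly_scale sA (ev1 (- lam1) r) (D a)"
  "g (sA r a) = ev1 (pd1 + lam1) r * g a" "T (sA r a) = poly_scale sA (ev1 (pd1 + lam1) r) (T a)"
  using semilinear_flag[THEN module_hom.scale] by (simp_all add: twist_def poly_scale_mult)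

lemma M_aa: "M (a, 0) (b, 0) = pair_x (m a b) 0"
  and M_ax: "M (a, 0) (0, x) = pair_x (D a) (h a)"
  and M_xa: "M (0, x) (a, 0) = pair_x (T a) (g a)"
  and M_xx: "M (0, x) (0, x) = pair_x Q0 P"
  by (simp_all add: flag_product_def flag_zero ev1.hom_one)

lemma conf_bilinear_M: "conf_bilinear sE M"
proof (intro conf_bilinear.intro conf_bilinear_axioms.intro E.cmodule_axioms)
  show "semilinear (- lam1) sE sE (\<lambda>u. M u v)" for v
    by (cases v) (auto simp: module_hom_iff E.module_axioms E.module_twist flag_product_def Let_def
      pair_x_add poly_scale_pair_x twist_def prod.scale_prod A.scale_l flag_scale ev1.hom_add
          ev1.hom_mult
      additive.add[OF A.additive_l] flag_additive[THEN additive.add] A.p.scale_left_distrib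
      A.p.scale_right_distrib algebra_simps)
  show "semilinear (pd1 + lam1) sE sE (M u)" for u
    by (cases u) (auto simp: module_hom_iff E.module_axioms E.module_twist flag_product_def Let_def
      pair_x_add poly_scale_pair_x twist_def prod.scale_prod A.scale_r flag_scale ev1.hom_add
          ev1.hom_mult
      additive.add[OF A.additive_r] flag_additive[THEN additive.add] A.p.scale_left_distrib
      A.p.scale_right_distrib algebra_simps)
qed

sublocale M: conf_bilinear sE M
  by (rule conf_bilinear_M)

section \<open>Associators of generators and the fourteen flag conditions\<close>

lemmas app_at_simps = A.app_at_subst_at[OF A.cmodule_axioms]
  R.app_at_subst_at[OF A.cmodule_axioms] flag_additive A.additive_l A.additive_r

lemma additive_0: "additive (\<lambda>_. 0)"
  by (intro additive.intro) simp

text \<open>The outer factor determines the maps entering \<open>comp_at_pair_x\<close>. Multiplying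
  by an element of A keeps A inside A, so the Q-component is the zero map; left multiplication by x
  contributes T and g, right multiplication by x contributes D and h.\<close>

lemma assoc_l_inl:
  assumes "M e e' = pair_x u p"
  shows "assoc_l sE M (a, 0) e e' = pair_x2
    (app_at sA (m a) lam (subst_at sA u mu) +
        poly_scale2 sA (coef_at p mu (lam + pd2)) (subst_at sA (D a) lam))
    (coef_at p mu (lam + pd2) * coef_at (h a) lam pd2)"
  unfolding assoc_l_def assms
  by (subst comp_at_pair_x[OF M.semi_r A.additive_r additive_0 M_aa M_ax])
    (simp add: app_at_simps coef_at_pd1_lam1 add.commute[of lam pd2])

lemma assoc_l_x:
  assumes "M e e' = pair_x u p"
  shows "assoc_l sE M (0, x) e e' = pair_x2
    (app_at sA T lam (subst_at sA u mu) +
        poly_scale2 sA (coef_at p mu (lam + pd2)) (subst_at sA Q0 lam))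
    (app_at (*) g lam (subst_at sA u mu) + coef_at p mu (lam + pd2) * coef_at P lam pd2)"
  unfolding assoc_l_def assms
  by (subst comp_at_pair_x[OF M.semi_r flag_additive(4,3) M_xa M_xx])
    (simp add: app_at_simps coef_at_pd1_lam1 add.commute[of lam pd2])

lemma assoc_r_inl:
  assumes "M e e' = pair_x u p"
  shows "assoc_r sE M e e' (b, 0) = pair_x2
    (app_at sA (\<lambda>a. m a b) (lam + mu) (subst_at sA u lam) +
      poly_scale2 sA (coef_at p lam (- lam - mu)) (subst_at sA (T b) (lam + mu)))
    (coef_at p lam (- lam - mu) * coef_at (g b) (lam + mu) pd2)"
  unfolding assoc_r_def assms
  by (subst comp_at_pair_x[OF M.semi_l A.additive_l additive_0 M_aa M_xa])
    (simp add: app_at_simps coef_at_neg_lam1)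

lemma assoc_r_x:
  assumes "M e e' = pair_x u p"
  shows "assoc_r sE M e e' (0, x) = pair_x2
    (app_at sA D (lam + mu) (subst_at sA u lam) +
      poly_scale2 sA (coef_at p lam (- lam - mu)) (subst_at sA Q0 (lam + mu)))
    (app_at (*) h (lam + mu) (subst_at sA u lam) + coef_at p lam (- lam - mu) * coef_at P (lam +
        mu) pd2)"
  unfolding assoc_r_def assms
  by (subst comp_at_pair_x[OF M.semi_l flag_additive(2,1) M_ax M_xx])
    (simp add: app_at_simps coef_at_neg_lam1)

lemma coef_at_0 [simp]: "coef_at 0 X Y = 0"
  by (rule additive.zero[OF coef_at.additive])

lemma assoc_aaa: "assoc_l sE M (a, 0) (b, 0) (c, 0) = assoc_r sE M (a, 0) (b, 0) (c, 0)"
  using assoc[of a b c]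
  unfolding assoc_l_inl[OF M_aa] assoc_r_inl[OF M_aa]
  by (simp add: app_at_simps assoc_l_def assoc_r_def)

text \<open>Each of the seven patterns containing x yields two flag conditions, the A-component and
  the coefficient of x. The patterns aax, axa, xaa, axx, xax, xxa, xxx give the conditions in
  consecutive pairs.\<close>

lemma assoc_aax_iff:
  "assoc_l sE M (a, 0) (b, 0) (0, x) = assoc_r sE M (a, 0) (b, 0) (0, x) \<longleftrightarrow>
    app_at sA D (lam + mu) (subst_at sA (m a b) lam)
      = app_at sA (m a) lam (subst_at sA (D b) mu)
        + poly_scale2 sA (coef_at (h b) mu (lam + pd2)) (subst_at sA (D a) lam) \<and>
    coef_at (h b) mu (lam + pd2) * coef_at (h a) lam pd2
      = app_at (*) h (lam + mu) (subst_at sA (m a b) lam)"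
  unfolding assoc_l_inl[OF M_ax] assoc_r_x[OF M_aa] pair_x2_eq_iff
  by (auto simp: eq_diff_eq add.commute)

lemma assoc_axa_iff:
  "assoc_l sE M (a, 0) (0, x) (b, 0) = assoc_r sE M (a, 0) (0, x) (b, 0) \<longleftrightarrow>
    app_at sA (m a) lam (subst_at sA (T b) mu)
        + poly_scale2 sA (coef_at (g b) mu (lam + pd2)) (subst_at sA (D a) lam)
      = app_at sA (\<lambda>d. m d b) (lam + mu) (subst_at sA (D a) lam)
        + poly_scale2 sA (coef_at (h a) lam (- lam - mu)) (subst_at sA (T b) (lam + mu)) \<and>
    coef_at (g b) mu (lam + pd2) * coef_at (h a) lam pd2
      = coef_at (h a) lam (- lam - mu) * coef_at (g b) (lam + mu) pd2"
  unfolding assoc_l_inl[OF M_xa] assoc_r_inl[OF M_ax] pair_x2_eq_iff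
  by (auto simp: add.commute)

lemma assoc_xaa_iff:
  "assoc_l sE M (0, x) (a, 0) (b, 0) = assoc_r sE M (0, x) (a, 0) (b, 0) \<longleftrightarrow>
    app_at sA T lam (subst_at sA (m a b) mu)
      = app_at sA (\<lambda>d. m d b) (lam + mu) (subst_at sA (T a) lam)
        + poly_scale2 sA (coef_at (g a) lam (- lam - mu)) (subst_at sA (T b) (lam + mu)) \<and>
    app_at (*) g lam (subst_at sA (m a b) mu)
      = coef_at (g a) lam (- lam - mu) * coef_at (g b) (lam + mu) pd2"
  unfolding assoc_l_x[OF M_aa] assoc_r_inl[OF M_xa] pair_x2_eq_iff
  by (auto simp: add.commute)

lemma assoc_axx_iff:
  "assoc_l sE M (a, 0) (0, x) (0, x) = assoc_r sE M (a, 0) (0, x) (0, x) \<longleftrightarrow>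
    poly_scale2 sA (coef_at P mu (lam + pd2)) (subst_at sA (D a) lam)
      = app_at sA D (lam + mu) (subst_at sA (D a) lam)
        + poly_scale2 sA (coef_at (h a) lam (- lam - mu)) (subst_at sA Q0 (lam + mu))
        - app_at sA (m a) lam (subst_at sA Q0 mu) \<and>
    coef_at P mu (lam + pd2) * coef_at (h a) lam pd2
      = coef_at (h a) lam (- lam - mu) * coef_at P (lam + mu) pd2
        + app_at (*) h (lam + mu) (subst_at sA (D a) lam)"
  unfolding assoc_l_inl[OF M_xx] assoc_r_x[OF M_ax] pair_x2_eq_iff
  by (auto simp: eq_diff_eq add.commute)

lemma assoc_xax_iff:
  "assoc_l sE M (0, x) (a, 0) (0, x) = assoc_r sE M (0, x) (a, 0) (0, x) \<longleftrightarrow>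
    app_at sA T lam (subst_at sA (D a) mu)
        + poly_scale2 sA (coef_at (h a) mu (lam + pd2)) (subst_at sA Q0 lam)
      = app_at sA D (lam + mu) (subst_at sA (T a) lam)
        + poly_scale2 sA (coef_at (g a) lam (- lam - mu)) (subst_at sA Q0 (lam + mu)) \<and>
    app_at (*) g lam (subst_at sA (D a) mu)
        + coef_at (h a) mu (lam + pd2) * coef_at P lam pd2
      = app_at (*) h (lam + mu) (subst_at sA (T a) lam)
        + coef_at (g a) lam (- lam - mu) * coef_at P (lam + mu) pd2"
  unfolding assoc_l_x[OF M_ax] assoc_r_x[OF M_xa] pair_x2_eq_iff
  by (auto simp: add.commute)

lemma assoc_xxa_iff:
  "assoc_l sE M (0, x) (0, x) (a, 0) = assoc_r sE M (0, x) (0, x) (a, 0) \<longleftrightarrow>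
    app_at sA T lam (subst_at sA (T a) mu)
        + poly_scale2 sA (coef_at (g a) mu (lam + pd2)) (subst_at sA Q0 lam)
      = app_at sA (\<lambda>d. m d a) (lam + mu) (subst_at sA Q0 lam)
        + poly_scale2 sA (coef_at P lam (- lam - mu)) (subst_at sA (T a) (lam + mu)) \<and>
    app_at (*) g lam (subst_at sA (T a) mu)
        + coef_at (g a) mu (lam + pd2) * coef_at P lam pd2
      = coef_at P lam (- lam - mu) * coef_at (g a) (lam + mu) pd2"
  unfolding assoc_l_x[OF M_xa] assoc_r_inl[OF M_xx] pair_x2_eq_iff
  by (auto simp: add.commute)

lemma assoc_xxx_iff:
  "assoc_l sE M (0, x) (0, x) (0, x) = assoc_r sE M (0, x) (0, x) (0, x) \<longleftrightarrow>
    app_at sA T lam (subst_at sA Q0 mu)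
        + poly_scale2 sA (coef_at P mu (lam + pd2)) (subst_at sA Q0 lam)
      = app_at sA D (lam + mu) (subst_at sA Q0 lam)
        + poly_scale2 sA (coef_at P lam (- lam - mu)) (subst_at sA Q0 (lam + mu)) \<and>
    app_at (*) g lam (subst_at sA Q0 mu)
        + coef_at P mu (lam + pd2) * coef_at P lam pd2
      = app_at (*) h (lam + mu) (subst_at sA Q0 lam)
        + coef_at P lam (- lam - mu) * coef_at P (lam + mu) pd2"
  unfolding assoc_l_x[OF M_xx] assoc_r_x[OF M_xx] pair_x2_eq_iff
  by (auto simp: add.commute)

text \<open>The conditions on V and x cover all triples of generators, because triples inside V are
  settled by associativity of A; generators suffice for all elements.\<close>

lemma FAC_iff_assoc:
  "(h, D, g, T, Q0, P) \<in> FAC sA m V \<longleftrightarrow> (\<forall>e e' e''. assoc_l sE M e e' e'' = assoc_r sE M e e' e'')"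
proof
  assume FAC: "(h, D, g, T, Q0, P) \<in> FAC sA m V"
  let ?B = "(\<lambda>a. (a, 0)) ` V \<union> {(0, x)}"
  have "assoc_l sE M e e' e'' = assoc_r sE M e e' e''" if "e \<in> ?B" "e' \<in> ?B" "e'' \<in> ?B" for e e' e''
    using that
    by (elim UnE imageE singletonE; hypsubst)
      (use FAC in \<open>simp_all only: FAC_def mem_Collect_eq case_prod_conv assoc_aaa
        assoc_aax_iff assoc_axa_iff assoc_xaa_iff assoc_axx_iff assoc_xax_iff assoc_xxa_iff
            assoc_xxx_iff\<close>)
  then show "\<forall>e e' e''. assoc_l sE M e e' e'' = assoc_r sE M e e' e''"
    using M.assoc_on_generators[OF span_inl[OF V_span]] by blast
next
  assume *: "\<forall>e e' e''. assoc_l sE M e e' e'' = assoc_r sE M e e' e''"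
  note iffs = assoc_aax_iff assoc_axa_iff assoc_xaa_iff assoc_axx_iff assoc_xax_iff assoc_xxa_iff
    assoc_xxx_iff
  note eqs = iffs[THEN iffD1, OF *[rule_format], THEN conjunct1]
    iffs[THEN iffD1, OF *[rule_format], THEN conjunct2]
  show "(h, D, g, T, Q0, P) \<in> FAC sA m V"
    unfolding FAC_def mem_Collect_eq case_prod_conv
    by (intro conjI ballI eqs)
      (simp_all add: semilinear_flag left_conformal_linear_iff conformal_linear_iff
        A.cmodule_axioms cmodule_mult)
qed

end

section \<open>Flags correspond bijectively to structures on the direct sum\<close>

context rank1_extension
begin

lemma flag_datumI: "flag_maps sA (h, D, g, T, Q0, P) \<Longrightarrow> flag_datum sA m sQ x V h D g T Q0 P"
  by (intro flag_datum.intro flag_datum_axioms.intro rank1_extension_axioms)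

lemma FAC_flag_maps: "d \<in> FAC sA m V \<Longrightarrow> flag_maps sA d"
  by (cases d rule: prod_cases6)
    (simp add: FAC_def flag_maps_def left_conformal_linear_iff conformal_linear_iff
      A.cmodule_axioms cmodule_mult)

lemma flag_product_in_sum_structures_iff:
  assumes "flag_maps sA d"
  shows "flag_product m d \<in> sum_structures sA m sQ \<longleftrightarrow> d \<in> FAC sA m V"
proof -
  obtain h D g T Q0 P where d: "d = (h, D, g, T, Q0, P)"
    by (rule prod_cases6)
  interpret flag_datum sA m sQ x V h D g T Q0 P
    using assms unfolding d by (rule flag_datumI)
  show ?thesis
    unfolding d FAC_iff_assoc sum_structures_def mem_Collect_eq assoc_conformal_algebra_iff
    by (simp add: conf_bilinear_M M_aa pair_x_def)
qed

text \<open>Settles the definite description: the explicit product has the prescribed values, and a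
  conformal bilinear map is determined by its values on generators.\<close>

lemma AC_eq_flag_product:
  assumes "flag_maps sA d"
  shows "AC sA m V sQ x d = flag_product m d"
proof -
  obtain h D g T Q0 P where d: "d = (h, D, g, T, Q0, P)"
    by (rule prod_cases6)
  interpret flag_datum sA m sQ x V h D g T Q0 P
    using assms unfolding d by (rule flag_datumI)
  have bil: "conformal_bilinear sE sE sE N \<longleftrightarrow> conf_bilinear sE N" for N
    by (simp add: conformal_bilinear_iff E.cmodule_axioms conf_bilinear_def
        conf_bilinear_axioms_def)
  show ?thesis
    unfolding d AC_def Let_def case_prod_conv bil
  proof (rule the_equality)
    fix N assume N: "conf_bilinear sE N \<and>
       (\<forall>a\<in>V. \<forall>b\<in>V. N (a, 0) (b, 0) = pair_poly (m a b) 0) \<and>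
       N (0, x) (0, x) = pair_poly Q0 (map_poly (\<lambda>r. sQ r x) P) \<and>
       (\<forall>a\<in>V. N (a, 0) (0, x) = pair_poly (D a) (map_poly (\<lambda>r. sQ r x) (h a))) \<and>
       (\<forall>a\<in>V. N (0, x) (a, 0) = pair_poly (T a) (map_poly (\<lambda>r. sQ r x) (g a)))"
    then have "conf_bilinear sE N" by blast
    from this conf_bilinear_M span_inl[OF V_span] show "N = M"
      by (rule conf_bilinear_eqI) (use N in \<open>auto simp: M_aa M_ax M_xa M_xx pair_x_def\<close>)
  qed (simp add: conf_bilinear_M M_aa M_ax M_xa M_xx, simp add: pair_x_def)
qed

definition flag_of :: "('a \<times> 'q \<Rightarrow> 'a \<times> 'q \<Rightarrow> ('a \<times> 'q) poly) \<Rightarrow> 'a flag" where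
  "flag_of N =
    (\<lambda>a. map_poly (coord \<circ> snd) (N (a, 0) (0, x)), \<lambda>a. map_poly fst (N (a, 0) (0, x)),
     \<lambda>a. map_poly (coord \<circ> snd) (N (0, x) (a, 0)), \<lambda>a. map_poly fst (N (0, x) (a, 0)),
     map_poly fst (N (0, x) (0, x)), map_poly (coord \<circ> snd) (N (0, x) (0, x)))"

lemma map_poly_fst_pair_x [simp]: "map_poly fst (pair_x u p) = u"
  by (simp add: pair_x_def)

lemma map_poly_coord_snd_pair_x [simp]: "map_poly (coord \<circ> snd) (pair_x u p) = p"
proof -
  have "map_poly (coord \<circ> snd) (pair_x u p) = map_poly coord (map_poly snd (pair_x u p))"
    by (simp add: map_poly_map_poly)
  then show ?thesis
    by (simp add: pair_x_def)
qed

lemma pair_x_fst_coord_snd: "pair_x (map_poly fst W) (map_poly (coord \<circ> snd) W) = W"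
  by (cases W rule: pair_x_cases) simp

lemma flag_of_flag_product:
  assumes "flag_maps sA d"
  shows "flag_of (flag_product m d) = d"
proof -
  obtain h D g T Q0 P where d: "d = (h, D, g, T, Q0, P)"
    by (rule prod_cases6)
  interpret flag_datum sA m sQ x V h D g T Q0 P
    using assms unfolding d by (rule flag_datumI)
  show ?thesis
    unfolding d flag_of_def by (simp add: M_ax M_xa M_xx)
qed

lemma flag_maps_flag_of:
  assumes "N \<in> sum_structures sA m sQ"
  shows "flag_maps sA (flag_of N)"
proof -
  interpret N: conf_bilinear sE N
    using assms by (rule sum_structures_conf_bilinear)
  note p = module_hom_compose[OF prod.module_hom_snd module_hom_coord]
  show ?thesis
    unfolding flag_of_def flag_maps_def case_prod_conv
    by (intro conjI semilinear_compose[OF N.semi_l module_hom_inl] semilinear_compose[OF N.semi_r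
        module_hom_inl]
        p prod.module_hom_fst)
qed

lemma flag_product_flag_of:
  assumes "N \<in> sum_structures sA m sQ"
  shows "flag_product m (flag_of N) = N"
proof -
  obtain h D g T Q0 P where d: "flag_of N = (h, D, g, T, Q0, P)"
    by (rule prod_cases6)
  interpret flag_datum sA m sQ x V h D g T Q0 P
    using flag_maps_flag_of[OF assms] unfolding d by (rule flag_datumI)
  have "N (a, 0) (0, x) = pair_x (D a) (h a)" "N (0, x) (a, 0) = pair_x (T a) (g a)"
    "N (0, x) (0, x) = pair_x Q0 P" for a
    using d pair_x_fst_coord_snd unfolding flag_of_def by auto
  moreover have "N (a, 0) (b, 0) = pair_x (m a b) 0" for a b
    using assms by (simp add: sum_structures_def pair_x_def)
  ultimately have "M e e' = N e e'"
      if "e \<in> (\<lambda>a. (a, 0)) ` V \<union> {(0, x)}" "e' \<in> (\<lambda>a. (a, 0)) ` V \<union> {(0, x)}" for e e'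
    using that by (auto simp: M_aa M_ax M_xa M_xx)
  with conf_bilinear_M sum_structures_conf_bilinear[OF assms] span_inl[OF V_span] show ?thesis
    unfolding d by (rule conf_bilinear_eqI)
qed

lemma bij_betw_AC: "bij_betw (AC sA m V sQ x) (FAC sA m V) (sum_structures sA m sQ)"
proof (rule bij_betw_byWitness[of _ flag_of])
  show "\<forall>d\<in>FAC sA m V. flag_of (AC sA m V sQ x d) = d"
    by (simp add: AC_eq_flag_product FAC_flag_maps flag_of_flag_product)
  show "\<forall>N\<in>sum_structures sA m sQ. AC sA m V sQ x (flag_of N) = N"
    by (simp add: AC_eq_flag_product flag_maps_flag_of flag_product_flag_of)
  show "AC sA m V sQ x ` FAC sA m V \<subseteq> sum_structures sA m sQ"
    by (auto simp: AC_eq_flag_product FAC_flag_maps flag_product_in_sum_structures_iff)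
  show "flag_of ` sum_structures sA m sQ \<subseteq> FAC sA m V"
    using flag_product_in_sum_structures_iff[OF flag_maps_flag_of]
        by (auto simp: flag_product_flag_of)
qed

section \<open>Isomorphisms in terms of flags\<close>

lemma poly_scale_const_right: "poly_scale sA p [:a:] = map_poly (\<lambda>r. sA r a) p"
proof (induction p rule: poly_monom_induct)
  case (monom r i)
  show ?case
    using A.poly_scale_monom[of r i a 0] by (simp add: monom_0 map_poly_monom)
next
  case (add p q)
  have "additive (\<lambda>r. sA r a)"
    by (intro additive.intro) (rule A.scale_left_distrib)
  with add show ?case
    by (simp add: A.p.scale_left_distrib map_poly_add)
qed

text \<open>The isomorphism sends p x to p u(x) + \<beta> p x. The first term is the source of the
  corrections by h, g and P times \<open>T0\<close> in the relation on flags.\<close>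

lemma map_poly_sum_map_pair_x:
  assumes u: "module_hom sQ sA u" and v: "module_hom sQ sQ v" and vx: "v x = sQ [:\<beta>:] x"
  shows "map_poly (sum_map u v) (pair_x w p) = pair_x (w + poly_scale sA p [:u x:]) (smult [:\<beta>:] p)"
proof -
  have "map_poly u (map_poly (\<lambda>r. sQ r x) p) = map_poly (\<lambda>r. sA r (u x)) p"
    using module_hom.scale[OF u] by (simp add: map_poly_map_poly o_def module_hom.zero[OF u])
  moreover have "map_poly v (map_poly (\<lambda>r. sQ r x) p) = map_poly (\<lambda>r. sQ r x) (smult [:\<beta>:] p)"
    using module_hom.scale[OF v]
    by (simp add: map_poly_map_poly o_def smult_conv_map_poly module_hom.zero[OF v] vx mult.commute)
  ultimately show ?thesis
    by (simp add: pair_x_def map_poly_sum_map module_hom.zero[OF u] module_hom.zero[OF v]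
        poly_scale_const_right)
qed

text \<open>Products of generators are compared. In the Q-components both sides carry a common
  factor \<beta>; cancelling it gives h = h', g = g' and the equation for P, in which only one
  factor \<beta> is left.\<close>

lemma flag_related_iff:
  assumes d: "flag_maps sA d" "flag_maps sA d'"
    and u: "module_hom sQ sA u" and v: "module_hom sQ sQ v" and vx: "v x = sQ [:\<beta>:] x" "\<beta> \<noteq> 0"
  shows "flag_related sA m (u x) \<beta> d d' \<longleftrightarrow>
    (\<forall>e e'. map_poly (sum_map u v) (flag_product m d e e') =
       flag_product m d' (sum_map u v e) (sum_map u v e'))"
    (is "_ \<longleftrightarrow> ?iso")
proof -
  obtain h D g T Q0 P where d1: "d = (h, D, g, T, Q0, P)"
    by (rule prod_cases6)
  obtain h' D' g' T' Q0' P' where d2: "d' = (h', D', g', T', Q0', P')"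
    by (rule prod_cases6)
  interpret d: flag_datum sA m sQ x V h D g T Q0 P
    using d(1) unfolding d1 by (rule flag_datumI)
  interpret d': flag_datum sA m sQ x V h' D' g' T' Q0' P'
    using d(2) unfolding d2 by (rule flag_datumI)
  let ?\<phi> = "sum_map u v"
  have \<phi>: "module_hom sE sE ?\<phi>"
    by (rule module_hom_sum_map[OF u v])
  have \<phi>_a: "?\<phi> (a, 0) = (a, 0)" and \<phi>_x: "?\<phi> (0, x) = (u x, sQ [:\<beta>:] x)" for a
    by (simp_all add: module_hom.zero[OF u] module_hom.zero[OF v] vx)
  have M1: "conf_bilinear sE (\<lambda>e e'. map_poly ?\<phi> (d.M e e'))"
    using semilinear_compose[OF d.M.semi_l E.module_hom_ident \<phi>]
      semilinear_compose[OF d.M.semi_r E.module_hom_ident \<phi>]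
    by (simp add: conf_bilinear_def conf_bilinear_axioms_def E.cmodule_axioms)
  have M2: "conf_bilinear sE (\<lambda>e e'. d'.M (?\<phi> e) (?\<phi> e'))"
    using semilinear_compose[OF d'.M.semi_l \<phi> E.module_hom_ident]
      semilinear_compose[OF d'.M.semi_r \<phi> E.module_hom_ident]
    by (simp add: conf_bilinear_def conf_bilinear_axioms_def E.cmodule_axioms)
  \<comment> \<open>All of A is taken instead of V, because the relation on flags quantifies over
    every a in A.\<close>
  let ?B = "(\<lambda>a. (a, 0)) ` UNIV \<union> {(0, x)}"
  have "?iso \<longleftrightarrow> (\<forall>e\<in>?B. \<forall>e'\<in>?B. map_poly ?\<phi> (d.M e e') = d'.M (?\<phi> e) (?\<phi> e'))"
  proof
    assume "\<forall>e\<in>?B. \<forall>e'\<in>?B. map_poly ?\<phi> (d.M e e') = d'.M (?\<phi> e) (?\<phi> e')"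
    then have "(\<lambda>e e'. map_poly ?\<phi> (d.M e e')) = (\<lambda>e e'. d'.M (?\<phi> e) (?\<phi> e'))"
      by (intro conf_bilinear_eqI[OF M1 M2 span_inl[OF A.span_UNIV]]) blast
    then show ?iso
      unfolding d1 d2 by (simp add: fun_eq_iff)
  qed (simp add: d1 d2)
  also have "\<dots> \<longleftrightarrow>
    (\<forall>a b. map_poly ?\<phi> (d.M (a, 0) (b, 0)) = d'.M (a, 0) (b, 0)) \<and>
    (\<forall>a. map_poly ?\<phi> (d.M (a, 0) (0, x)) = d'.M (a, 0) (u x, sQ [:\<beta>:] x)) \<and>
    (\<forall>a. map_poly ?\<phi> (d.M (0, x) (a, 0)) = d'.M (u x, sQ [:\<beta>:] x) (a, 0)) \<and>
    map_poly ?\<phi> (d.M (0, x) (0, x)) = d'.M (u x, sQ [:\<beta>:] x) (u x, sQ [:\<beta>:] x)"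
    unfolding ball_Un ball_simps \<phi>_a \<phi>_x by blast
  also have "\<dots> \<longleftrightarrow>
    (\<forall>a. D a + poly_scale sA (h a) [:u x:] = m a (u x) + complex_poly_scale sA \<beta> (D' a) \<and> h a =
        h' a) \<and>
    (\<forall>a. T a + poly_scale sA (g a) [:u x:] = m (u x) a + complex_poly_scale sA \<beta> (T' a) \<and> g a =
        g' a) \<and>
    Q0 + poly_scale sA P [:u x:] = m (u x) (u x) + complex_poly_scale sA \<beta> (D' (u x))
      + complex_poly_scale sA \<beta> (T' (u x)) + complex_poly_scale sA (\<beta>\<^sup>2) Q0' \<and>
    P = h' (u x) + g' (u x) + smult [:\<beta>:] P'"
  proof -
    \<comment> \<open>Cancellation is possible because \<beta> is nonzero and the polynomial ring
      has no zero divisors.\<close>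
    have smult: "smult [:\<beta>:] p = smult [:\<beta>:] q \<longleftrightarrow> p = q" for p q :: "complex poly poly"
      using vx(2) smult_eq_0_iff[of "[:\<beta>:]" "p - q"] by (auto simp: smult_diff_right)
    have 1: "d'.M (a, 0) (u x, sQ [:\<beta>:] x) =
        pair_x (m a (u x) + complex_poly_scale sA \<beta> (D' a)) (smult [:\<beta>:] (h' a))" for a
      by (simp add: flag_product_def d'.flag_zero ev1_const complex_poly_scale_def)
    have 2: "d'.M (u x, sQ [:\<beta>:] x) (a, 0) =
        pair_x (m (u x) a + complex_poly_scale sA \<beta> (T' a)) (smult [:\<beta>:] (g' a))" for a
      by (simp add: flag_product_def d'.flag_zero ev1_const complex_poly_scale_def)
    \<comment> \<open>As a constant, \<beta> passes both arguments untwisted. The mixed terms carry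
      one factor \<beta>, the product of x with itself carries \<beta> squared.\<close>
    have "d'.M (u x, sQ [:\<beta>:] x) (u x, sQ [:\<beta>:] x) =
        pair_x (m (u x) (u x) + complex_poly_scale sA \<beta> (D' (u x))
          + complex_poly_scale sA \<beta> (T' (u x)) + complex_poly_scale sA (\<beta>\<^sup>2) Q0')
          (smult [:\<beta>:] (h' (u x) + g' (u x) + smult [:\<beta>:] P'))"
      by (simp add: flag_product_def Let_def ev1_const complex_poly_scale_def power2_eq_square
          smult_add_right)
    then show ?thesis
      by (simp only: d.M_aa d'.M_aa d.M_ax d.M_xa d.M_xx map_poly_sum_map_pair_x[OF u v vx(1)]
          1 2 pair_x_eq_iff smult A.p.scale_zero_left smult_0_right add_0_right simp_thms)
  qed
  also have "\<dots> \<longleftrightarrow> flag_related sA m (u x) \<beta> d d'"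
    unfolding d1 d2 flag_related_def case_prod_conv fun_eq_iff eq_diff_eq by blast
  finally show ?thesis ..
qed

lemma bij_hom_Q:
  assumes v: "module_hom sQ sQ v" and bij: "bij v"
  obtains \<beta> where "\<beta> \<noteq> 0" "v x = sQ [:\<beta>:] x"
proof -
  \<comment> \<open>The coordinate of a preimage of x is an inverse of the coordinate of
    v(x).\<close>
  obtain y where "v y = x"
    using bij by (metis bij_pointE)
  then have "sQ (coord y * coord (v x)) x = sQ 1 x"
    using hom_Q_eq[OF v, of y] by (simp flip: Q.scale_scale)
  then have "coord y * coord (v x) = 1"
    by (simp only: scale_x_inj)
  then have "coord (v x) dvd 1"
    by (metis dvd_triv_right)
  then obtain \<beta> where "coord (v x) = [:\<beta>:]" "\<beta> \<noteq> 0"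
    by (auto simp: is_unit_poly_iff dvd_field_iff)
  with that[of \<beta>] show ?thesis
    by (metis scale_coord)
qed

lemma module_hom_scale_const: "module_hom sQ sQ (\<lambda>y. sQ [:\<beta>:] y)"
  by unfold_locales (simp_all add: Q.scale_right_distrib mult.commute)

lemma bij_scale_const: "\<beta> \<noteq> 0 \<Longrightarrow> bij (\<lambda>y. sQ [:\<beta>:] y)"
  by (rule o_bij[of "\<lambda>y. sQ [:inverse \<beta>:] y"]) (simp_all add: fun_eq_iff flip: one_pCons)

text \<open>Because x is a free generator, its image in A can be prescribed: every choice of
  \<open>T0\<close> comes from a homomorphism u.\<close>

lemma module_hom_extend: "module_hom sQ sA (\<lambda>y. sA (coord y) a)"
  by unfold_locales (simp_all add: A.scale_left_distrib)

lemma flag_equiv_rel_bij: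
  "rel_bij (AC sA m V sQ x) (FAC sA m V) (sum_structures sA m sQ) (flag_equiv sA m V)
      (structure_equiv sA m sQ)"
proof
  show "bij_betw (AC sA m V sQ x) (FAC sA m V) (sum_structures sA m sQ)"
    by (rule bij_betw_AC)
  show "flag_equiv sA m V \<subseteq> FAC sA m V \<times> FAC sA m V"
    by (auto simp: flag_equiv_def)
  show "structure_equiv sA m sQ \<subseteq> sum_structures sA m sQ \<times> sum_structures sA m sQ"
    by (auto simp: structure_equiv_def)
  fix d d' assume d: "d \<in> FAC sA m V" "d' \<in> FAC sA m V"
  note fm = d[THEN FAC_flag_maps]
  have "AC sA m V sQ x d \<in> sum_structures sA m sQ" "AC sA m V sQ x d' \<in> sum_structures sA m sQ"
    using bij_betw_AC d by (auto simp: bij_betw_def)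
  moreover have "(\<exists>T0 \<beta>. \<beta> \<noteq> 0 \<and> flag_related sA m T0 \<beta> d d') \<longleftrightarrow>
     (\<exists>u v. module_hom sQ sA u \<and> module_hom sQ sQ v \<and> bij v \<and>
       (\<forall>e e'. map_poly (sum_map u v) (flag_product m d e e') =
         flag_product m d' (sum_map u v e) (sum_map u v e')))" (is "?L \<longleftrightarrow> ?R")
  proof
    assume ?L
    then obtain T0 \<beta> where "\<beta> \<noteq> 0" "flag_related sA m T0 \<beta> d d'"
      by blast
    then show ?R
      using flag_related_iff[OF fm module_hom_extend[of T0] module_hom_scale_const[of \<beta>]]
        module_hom_extend[of T0] module_hom_scale_const[of \<beta>] bij_scale_const[of \<beta>]
      by (intro exI[of _ "\<lambda>y. sA (coord y) T0"] exI[of _ "\<lambda>y. sQ [:\<beta>:] y"]) auto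
  next
    assume ?R
    then obtain u v where uv: "module_hom sQ sA u" "module_hom sQ sQ v" "bij v"
      "\<forall>e e'. map_poly (sum_map u v) (flag_product m d e e') =
         flag_product m d' (sum_map u v e) (sum_map u v e')"
      by blast
    moreover obtain \<beta> where "\<beta> \<noteq> 0" "v x = sQ [:\<beta>:] x"
      using bij_hom_Q[OF uv(2,3)] .
    ultimately show ?L
      using flag_related_iff[OF fm uv(1,2)] by blast
  qed
  ultimately show "(d, d') \<in> flag_equiv sA m V \<longleftrightarrow>
      (AC sA m V sQ x d, AC sA m V sQ x d') \<in> structure_equiv sA m sQ"
    unfolding structure_equiv_def flag_equiv_def mem_Collect_eq case_prod_conv ex_stabilizing_iso
    by (simp add: d fm AC_eq_flag_product del: split_paired_All)
qed

lemma flag_cohom_rel_bij: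
  "rel_bij (AC sA m V sQ x) (FAC sA m V) (sum_structures sA m sQ) (flag_cohom sA m V)
      (structure_cohom sA m sQ)"
proof
  show "bij_betw (AC sA m V sQ x) (FAC sA m V) (sum_structures sA m sQ)"
    by (rule bij_betw_AC)
  show "flag_cohom sA m V \<subseteq> FAC sA m V \<times> FAC sA m V"
    by (auto simp: flag_cohom_def)
  show "structure_cohom sA m sQ \<subseteq> sum_structures sA m sQ \<times> sum_structures sA m sQ"
    by (auto simp: structure_cohom_def)
  fix d d' assume d: "d \<in> FAC sA m V" "d' \<in> FAC sA m V"
  note fm = d[THEN FAC_flag_maps]
  have "AC sA m V sQ x d \<in> sum_structures sA m sQ" "AC sA m V sQ x d' \<in> sum_structures sA m sQ"
    using bij_betw_AC d by (auto simp: bij_betw_def)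
  moreover have "flag_related sA m (u x) 1 d d' \<longleftrightarrow>
       (\<forall>e e'. map_poly (sum_map u id) (flag_product m d e e') =
         flag_product m d' (sum_map u id e) (sum_map u id e'))" if "module_hom sQ sA u" for u
    by (rule flag_related_iff[OF fm that Q.module_hom_id]) (simp_all flip: one_pCons)
  then have "(\<exists>T0. flag_related sA m T0 1 d d') \<longleftrightarrow>
     (\<exists>u. module_hom sQ sA u \<and>
       (\<forall>e e'. map_poly (sum_map u id) (flag_product m d e e') =
         flag_product m d' (sum_map u id e) (sum_map u id e')))"
    \<comment> \<open>The homomorphism extending \<open>T0\<close> takes the value 1 times
      \<open>T0\<close> at x.\<close>
    using module_hom_extend by (metis A.scale_one coord_x)
  ultimately show "(d, d') \<in> flag_cohom sA m V \<longleftrightarrow>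
      (AC sA m V sQ x d, AC sA m V sQ x d') \<in> structure_cohom sA m sQ"
    unfolding structure_cohom_def flag_cohom_def mem_Collect_eq case_prod_conv ex_costabilizing_iso
    by (simp add: d fm AC_eq_flag_product del: split_paired_All)
qed

end

section \<open>Passage to the quotients\<close>

lemma bij_betw_quotients:
  assumes \<Omega>: "rel_bij e X S r s" and d: "rel_bij f Y S r' s" and s: "equiv S s"
  shows "equiv Y r' \<and> (\<exists>F. bij_betw F (S // s) (X // r)) \<and> (\<exists>F. bij_betw F (X // r) (Y // r')) \<and>
    (\<exists>F. bij_betw F (Y // r') (S // s) \<and> (\<forall>d\<in>Y. F (r' `` {d}) = s `` {f d}))"
proof -
  interpret \<Omega>: rel_bij e X S r s by fact
  interpret d: rel_bij f Y S r' s by fact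
  note inv = bij_betw_inv_into[OF \<Omega>.bij_betw_quotient] bij_betw_inv_into[OF d.bij_betw_quotient]
  show ?thesis
    \<comment> \<open>The bijection between the classes of X and of Y goes through the classes of S:
      the image map of e, followed by the inverse of the image map of f.\<close>
    using d.equiv_transfer[OF s] inv(1) bij_betw_trans[OF \<Omega>.bij_betw_quotient inv(2)]
      d.bij_betw_quotient d.image_class by blast
qed

theorem theorem5p3:
  fixes sA :: "complex poly \<Rightarrow> 'a::ab_group_add \<Rightarrow> 'a"
    and m :: "'a \<Rightarrow> 'a \<Rightarrow> 'a poly"
    and V :: "'a set"
    and sQ :: "complex poly \<Rightarrow> 'q::ab_group_add \<Rightarrow> 'q"
    and x :: 'q
  assumes "assoc_conformal_algebra sA m"
    and "free_over sA V"
    and "module sQ" and "module.independent sQ {x}" and "module.span sQ {x} = UNIV"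
  shows
    "(equiv (FAC sA m V) (flag_equiv sA m V) \<and>
      (\<exists>F. bij_betw F (CExtd sA m sQ) (AH2_A sA m sQ)) \<and>
      (\<exists>F. bij_betw F (AH2_A sA m sQ) (FAC sA m V // flag_equiv sA m V)) \<and>
      (\<exists>F. bij_betw F (FAC sA m V // flag_equiv sA m V) (CExtd sA m sQ) \<and>
           (\<forall>d \<in> FAC sA m V.
              F (flag_equiv sA m V `` {d}) = structure_equiv sA m sQ `` {AC sA m V sQ x d}))) \<and>
     (equiv (FAC sA m V) (flag_cohom sA m V) \<and>
      (\<exists>F. bij_betw F (CExtd' sA m sQ) (AH2 sA m sQ)) \<and>
      (\<exists>F. bij_betw F (AH2 sA m sQ) (FAC sA m V // flag_cohom sA m V)) \<and>
      (\<exists>F. bij_betw F (FAC sA m V // flag_cohom sA m V) (CExtd' sA m sQ) \<and>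
           (\<forall>d \<in> FAC sA m V.
              F (flag_cohom sA m V `` {d}) = structure_cohom sA m sQ `` {AC sA m V sQ x d})))"
proof -
  have A: "conf_bilinear sA m" "\<And>a b c. assoc_l sA m a b c = assoc_r sA m a b c"
    using assms(1) by (simp_all add: assoc_conformal_algebra_iff)
  then interpret A: conf_bilinear sA m by simp
  interpret C: vector_space "complex_scale sA"
    by (rule A.vector_space_complex_scale)
  obtain B where B: "V = C.span B" "A.span B = UNIV"
    using assms(2) by (auto simp: free_over_def)
  \<comment> \<open>V contains the basis B, which spans A over C[\<partial>].\<close>
  then have "A.span V = UNIV"
    using A.span_mono[OF C.span_superset, of B] by auto
  then interpret rank1_extension sA m sQ x V
    using A assms(3-5)
    by (intro rank1_extension.intro rank1_sum.intro conf_extension.intro sum_module.intro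
        rank1_sum_axioms.intro rank1_extension_axioms.intro)
            (simp_all add: cmodule_def A.module_axioms)
  show ?thesis
    unfolding CExtd_def CExtd'_def AH2_A_def AH2_def
    by (rule conjI
        [OF bij_betw_quotients[OF ext_equiv_rel_bij flag_equiv_rel_bij equiv_structure_equiv]
            bij_betw_quotients[OF ext_cohom_rel_bij flag_cohom_rel_bij equiv_structure_cohom]])
qed

end
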